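(* The following four identities hold: $$\sum_{k=1}^\infty \frac{(-16)^k \big( (20k^2-8k+1) H_{4k-1} + \frac{k(28k-5)}{2k-1} \big)}{(2k-1)^2 k^3 \binom{2k}{k} \binom{4k}{2k}} = - \frac{5 \pi^4}{8},$$ $$\sum_{k=1}^\infty \frac{(-16)^k \big( (20k^2-8k+1) H_{2k-1} + \frac{2k(4k-1)}{2k-1} \big)}{(2k-1)^2 k^3 \binom{2k}{k} \binom{4k}{2k}} = - \frac{\pi^4}{4},$$ $$\sum_{k=1}^\infty \frac{(-16)^k \big( (20k^2-8k+1) (2H_{4k-1}-9H_{2k-1}) -8k \big)}{(2k-1)^2 k^3 \binom{2k}{k} \binom{4k}{2k}} = \pi^4,$$ and $$\sum_{k=1}^\infty \frac{(-16)^k \big( (20k^2-8k+1) (16H_{2k-1}^{(3)}-3H_{k-1}^{(3)}) - \frac{32k(4k-1)}{(2k-1)^3} \big)}{(2k-1)^2 k^3 \binom{2k}{k} \binom{4k}{2k}} = - 98 \zeta(3)^2.$$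
   Context: For integers $m\ge1$ and $n\ge0$, $H_n^{(m)}=\sum_{0<j\le n}\frac1{j^m}$ denotes the harmonic number of order $m$, and $H_n=H_n^{(1)}$ (so $H_0=H_0^{(m)}=0$). $\zeta$ is the Riemann zeta function. *)

theory Defs
  imports "HOL-Analysis.Analysis"
begin

definition harmonic :: "nat \<Rightarrow> nat \<Rightarrow> real" where
  "harmonic m n = (\<Sum>j=1..n. 1 / real j ^ m)"

lemma harmonic_1_eq_harm: "harmonic 1 n = harm n"
  by (simp add: harmonic_def harm_def divide_inverse)

(* The Dirichlet series of the Riemann zeta function. It represents zeta for real or complex s
   with real part greater than 1; outside this half-plane the value is not meaningful. *)
definition zeta :: "'a \<Rightarrow> 'a::{real_normed_field, banach, ln}" where
  "zeta s = (\<Sum>n. 1 / of_nat (Suc n) powr s)"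

end

theory Submission
  imports Defs "HOL-Real_Asymp.Real_Asymp"
begin

text \<open>
  All four identities are first-order perturbations of one hypergeometric transformation.

  For a monic cubic \<open>\<phi>\<close> and parameters \<open>a\<close>, \<open>e\<close> there is a well-poised hypergeometric term \<open>T n k\<close> such that
  \<open>F n k = (a + 2 n + 2 k) T n k\<close> and a rational multiple \<open>M n k\<close> of \<open>T n k\<close> satisfy
  \<open>F (n + 1) k - F n (k + 1) = M n (k + 1) - M n k\<close> (\<open>cubic_wp_term_WZ\<close>). Summed over a square, this
  turns \<open>\<Sum>n. F n 0 + M n 0\<close> into \<open>\<Sum>k. F 0 k\<close> plus boundary terms that vanish in the limit. Writing
  \<open>\<phi> t = (t + b) (t + c) (t + d)\<close>, the sum over \<open>k\<close> is Dougall's well-poised series with parameters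
  \<open>a; b, c, d, e\<close>, and the sum over \<open>n\<close> is an accelerated form of it in which \<open>a\<close> grows by 2 and
  \<open>b, c, d\<close> by 1 at each step. Keeping only the coefficients of \<open>\<phi>\<close> has an advantage: its constant term
  can be moved along the real line, although its three roots then move in the directions of the complex
  cube roots of a real number.

  At \<open>a = 1\<close>, \<open>\<phi> t = (t + 1/2) ^ 3\<close>, \<open>e = 1/2\<close> the accelerated terms are, up to the factor \<open>-16\<close>, those of the
  theorem without harmonic numbers: with \<open>k = n + 1\<close> the factor \<open>20 k\<^sup>2 - 8 k + 1\<close> arises as
  \<open>4 k (4 k - 1) + (2 k - 1)\<^sup>2\<close>, the two summands coming from \<open>F\<close> and \<open>M\<close>; and \<open>F 0 k = 1 / (2 k + 1) ^ 3\<close>.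
  Now let the parameters depend linearly on \<open>x\<close> and differentiate at \<open>x = 0\<close>. The logarithmic derivative of
  a product of linear factors is a harmonic sum, so harmonic numbers appear on the accelerated side
  (\<open>wp_logderiv_n_0\<close>), whereas the other side remains elementary. The differentiated pair has the same
  recurrence, and its boundary terms are \<open>O(log N / N)\<close> (\<open>acceleration\<close>). Three directions suffice.

  \<^item> Moving \<open>b, c, d, e\<close> together with \<open>a / 2\<close> keeps the series of the form \<open>\<Sum>k. 1 / (2 k + 1 + 2 x) ^ 3\<close>, up to
    a constant. Its derivative is a multiple of \<open>\<Sum>k. 1 / (2 k + 1) ^ 4 = pi ^ 4 / 96\<close>
    (\<open>series_difference\<close>).

  \<^item> Moving \<open>b\<close> and \<open>e\<close> in opposite directions changes nothing to first order, since Dougall's series is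
    symmetric in \<open>b\<close> and \<open>e\<close>; the derivative is 0 (\<open>series_vanishing\<close>).

  \<^item> Moving the constant term of \<open>\<phi>\<close> brings in harmonic numbers of order 3 only. With
    \<open>w j = 1 / (2 j + 1) ^ 3\<close> the derivative is a multiple of \<open>\<Sum>k. w k * (w k + 2 * (\<Sum>j<k. w j))\<close>, which
    is the square \<open>(\<Sum>k. w k)\<^sup>2 = (7/8 * zeta 3)\<^sup>2\<close> (\<open>series_cubes\<close>).

  The first three identities are linear combinations of the first two directions, and the fourth is the
  third direction.
\<close>

section \<open>A Wilf--Zeilberger pair attached to a monic cubic\<close>

text \<open>
  With \<open>\<phi> t = (t + b) (t + c) (t + d)\<close> the factor \<open>- \<phi> (- 1 - a - j)\<close> is
  \<open>(1 + a - b + j) (1 + a - c + j) (1 + a - d + j)\<close>, and \<open>- \<phi> (- (1 + a - e + j))\<close> is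
  \<open>(1 + a - b - e + j) (1 + a - c - e + j) (1 + a - d - e + j)\<close>. The intended value of \<open>\<sigma>\<close> is
  \<open>1 + 2 a - b - c - d - e\<close>. For \<open>n = 0\<close> this is the well-poised term without its factor \<open>a + 2 k\<close>.
\<close>
definition cubic_wp_term :: "(real \<Rightarrow> real) \<Rightarrow> real \<Rightarrow> real \<Rightarrow> real \<Rightarrow> nat \<Rightarrow> nat \<Rightarrow> real" where
  "cubic_wp_term \<phi> a e \<sigma> n k =
     (-1) ^ n * (\<Prod>j<n + k. \<phi> (real j) / - \<phi> (- 1 - a - real j))
     * (\<Prod>j<n. - \<phi> (- (1 + a - e + real j)) / (\<sigma> + real j))
     * (\<Prod>j<k. e + real j) / (\<Prod>j<2 * n + k. 1 + a - e + real j)"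

text \<open>
  The second divided difference of a monic cubic is the sum of its three nodes plus the coefficient of
  the square. Here the nodes are \<open>t\<close>, \<open>- a - t\<close> and \<open>- a - v\<close>, and the denominators have been cleared.
\<close>
lemma cubic_interpolation:
  fixes t v a s1 s2 s3 :: real
  assumes "\<And>t. \<phi> t = t ^ 3 + s1 * t\<^sup>2 + s2 * t + s3"
  shows "(t - v) * \<phi> t + (a + t + v) * \<phi> (- a - t)
       = (a + 2 * t) * (\<phi> (- a - v) - (t - v) * (a + t + v) * (2 * a + v - s1))"
  unfolding assms by algebra

text \<open>
  Dividing the claim by the common hypergeometric factor leaves a polynomial identity in \<open>\<phi>\<close> at the three
  points where the shifts of \<open>n\<close> and \<open>k\<close> evaluate it. It is \<open>cubic_interpolation\<close> with \<open>t = n + k + 1\<close> and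
  \<open>v = n + 1 - e\<close>.
\<close>
lemma cubic_wp_term_WZ:
  fixes a e s1 s2 s3 \<sigma> :: real and n k :: nat
  assumes \<phi>: "\<And>t. \<phi> t = t ^ 3 + s1 * t\<^sup>2 + s2 * t + s3"
    and \<sigma>: "\<sigma> = 1 + 2 * a - e - s1"
    and nz: "\<phi> (- 1 - a - real (n + k)) \<noteq> 0" "\<sigma> + real n \<noteq> 0"
      "1 + a - e + real (2 * n + k) \<noteq> 0" "1 + a - e + real (2 * n + k + 1) \<noteq> 0"
  defines "T \<equiv> cubic_wp_term \<phi> a e \<sigma>"
  shows "(a + 2 * real (Suc n) + 2 * real k) * T (Suc n) k - (a + 2 * real n + 2 * real (Suc k)) * T n (Suc k)
    = T n (Suc k) * \<phi> (real (n + Suc k)) / ((1 + a - e + real (2 * n + Suc k)) * (\<sigma> + real n))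
      - T n k * \<phi> (real (n + k)) / ((1 + a - e + real (2 * n + k)) * (\<sigma> + real n))"
proof -
  define c where "c = 1 + a - e + real (2 * n + k)"
  define s where "s = \<sigma> + real n"
  define p where "p = \<phi> (real (n + k))"
  define q where "q = \<phi> (- 1 - a - real (n + k))"
  define r where "r = \<phi> (- (1 + a - e + real n))"
  define p' where "p' = \<phi> (real (n + k + 1))"
  define t where "t = T n k"
  have nz': "c \<noteq> 0" "c + 1 \<noteq> 0" "s \<noteq> 0" "q \<noteq> 0"
    using nz by (auto simp: c_def s_def q_def)
  have idx: "2 * Suc n + k = Suc (Suc (2 * n + k))" "Suc n + k = Suc (n + k)" by auto
  have T1: "T (Suc n) k = t * (p * r / (- q * s * c * (c + 1)))"
  proof -
    have "T (Suc n) k = - t * (p / - q) * (- r / s) / (c * (c + 1))"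
      unfolding T_def t_def cubic_wp_term_def idx
      by (simp add: p_def q_def r_def s_def c_def algebra_simps add_ac divide_simps)
    moreover have "- t * (p / - q) * (- r / s) / d = t * (p * r / (- q * s * d))" for d
      by simp
    ultimately show ?thesis by (simp only: mult.assoc)
  qed
  have T2: "T n (Suc k) = t * (p * (e + real k) / (- q * c))"
    unfolding T_def t_def cubic_wp_term_def
    by (simp add: p_def q_def c_def algebra_simps add_ac divide_simps)
  define A where "A = a + 2 * (real n + real k + 1)"
  have key: "(e + real k) * p' + (c + 1) * q = A * (r - (e + real k) * (c + 1) * s)"
  proof -
    have "real (n + k + 1) - (real n + 1 - e) = e + real k"
      "a + real (n + k + 1) + (real n + 1 - e) = c + 1"
      "- a - real (n + k + 1) = - 1 - a - real (n + k)"
      "- a - (real n + 1 - e) = - (1 + a - e + real n)"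
      "2 * a + (real n + 1 - e) - s1 = s" "a + 2 * real (n + k + 1) = A"
      by (auto simp: c_def s_def \<sigma> A_def)
    thus ?thesis
      using cubic_interpolation[OF \<phi>, of "real (n + k + 1)" "real n + 1 - e" a]
      by (simp only: p'_def q_def r_def)
  qed
  have split: "A * (t * (p * r / (q' * s * c * d))) - A * (t * (p * u / (q' * c)))
      = t * p / (q' * s * c * d) * (A * (r - u * d * s))"
    "t * p / (q' * s * c * d) * (u * p' - d * q') = t * (p * u / (q' * c)) * p' / (d * s) - t * p / (c * s)"
    if "d \<noteq> 0" "q' \<noteq> 0" for d q' u
    using nz' that by (simp_all add: field_simps)
  have "A * (t * (p * r / (- q * s * c * (c + 1)))) - A * (t * (p * (e + real k) / (- q * c)))
      = t * p / (- q * s * c * (c + 1)) * ((e + real k) * p' - (c + 1) * (- q))"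
    using key nz' by (subst split(1)) simp_all
  also have "\<dots> = t * (p * (e + real k) / (- q * c)) * p' / ((c + 1) * s) - t * p / (c * s)"
    using nz' by (intro split(2)) auto
  finally have "A * T (Suc n) k - A * T n (Suc k) = T n (Suc k) * p' / ((c + 1) * s) - t * p / (c * s)"
    unfolding T1 T2 .
  thus ?thesis
    by (simp add: A_def p_def p'_def c_def s_def t_def algebra_simps)
qed

text \<open>
  Setting \<open>g = f + m\<close>, the hypothesis becomes the usual form
  \<open>f (n + 1) k - f n k = g n (k + 1) - g n k\<close>, which telescopes in \<open>n\<close> as well as in \<open>k\<close>.
\<close>
lemma WZ_boundary_identity:
  fixes f m :: "nat \<Rightarrow> nat \<Rightarrow> real"
  assumes "\<And>n k. f (Suc n) k - f n (Suc k) = m n (Suc k) - m n k"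
  shows "(\<Sum>n<N. f n 0 + m n 0) - (\<Sum>k<K. f 0 k) = (\<Sum>n<N. f n K + m n K) - (\<Sum>k<K. f N k)"
proof -
  have step: "(\<Sum>k<K. f (Suc n) k) - (\<Sum>k<K. f n k) = (f n K + m n K) - (f n 0 + m n 0)" for n
  proof -
    have "(\<Sum>k<K. f (Suc n) k) - (\<Sum>k<K. f n k) = (\<Sum>k<K. (f n (Suc k) + m n (Suc k)) - (f n k + m n k))"
      unfolding sum_subtractf [symmetric]
    proof (rule sum.cong)
      fix k show "f (Suc n) k - f n k = (f n (Suc k) + m n (Suc k)) - (f n k + m n k)"
        using assms[of n k] by simp
    qed simp
    thus ?thesis by (simp only: sum_lessThan_telescope[of "\<lambda>k. f n k + m n k"])
  qed
  have "(\<Sum>n<N. (f n K + m n K) - (f n 0 + m n 0)) = (\<Sum>k<K. f N k) - (\<Sum>k<K. f 0 k)"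
    unfolding step [symmetric] by (rule sum_lessThan_telescope)
  thus ?thesis by (simp add: sum_subtractf)
qed

section \<open>Differentiation in the parameters\<close>

text \<open>
  The derivative is expressed as value times logarithmic derivative, so that logarithmic derivatives add
  up along products even where a factor vanishes.
\<close>
definition has_logderiv :: "(real \<Rightarrow> real) \<Rightarrow> real \<Rightarrow> real \<Rightarrow> bool" where
  "has_logderiv f l x \<longleftrightarrow> (f has_field_derivative f x * l) (at x)"

lemma has_logderivI:
  assumes "(f has_field_derivative d) (at x)" "f x \<noteq> 0" "l = d / f x"
  shows "has_logderiv f l x"
  using assms by (simp add: has_logderiv_def)

lemma has_logderiv_const: "has_logderiv (\<lambda>_. c) 0 x"
  by (simp add: has_logderiv_def)

lemma has_logderiv_mult:
  assumes "has_logderiv f l x" "has_logderiv g m x"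
  shows "has_logderiv (\<lambda>x. f x * g x) (l + m) x"
  using DERIV_mult[OF assms[unfolded has_logderiv_def]]
  by (simp add: has_logderiv_def algebra_simps)

lemma has_logderiv_divide:
  assumes "has_logderiv f l x" "has_logderiv g m x" "g x \<noteq> 0"
  shows "has_logderiv (\<lambda>x. f x / g x) (l - m) x"
proof -
  have "(f x * l * g x - f x * (g x * m)) / (g x * g x) = f x / g x * (l - m)"
    using assms(3) by (simp add: field_simps)
  thus ?thesis
    using DERIV_divide[OF assms(1,2)[unfolded has_logderiv_def] assms(3)]
    by (simp only: has_logderiv_def)
qed

lemma has_logderiv_prod:
  assumes "\<And>i. i \<in> A \<Longrightarrow> has_logderiv (f i) (l i) x"
  shows "has_logderiv (\<lambda>x. \<Prod>i\<in>A. f i x) (\<Sum>i\<in>A. l i) x"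
  using assms by (induction A rule: infinite_finite_induct) (auto intro: has_logderiv_const has_logderiv_mult)

text \<open>
  The velocity of the parameters at \<open>x = 0\<close>: \<open>\<alpha>\<close> for \<open>a\<close>, \<open>\<epsilon>\<close> for \<open>e\<close>, \<open>\<beta>\<close> for the sum of the roots
  \<open>b + c + d\<close>, \<open>\<delta>\<close> for the constant term of the cubic in the variable \<open>t + 1/2\<close>, and \<open>\<kappa>\<close> for an overall
  factor, which serves to normalise the series \<open>\<Sum>k. F 0 k\<close>.
\<close>
locale direction =
  fixes \<alpha> \<beta> \<epsilon> \<delta> \<kappa> :: real
begin

definition cubic :: "real \<Rightarrow> real \<Rightarrow> real" where
  "cubic x t = (t + 1/2) ^ 3 + x * (\<beta> * (t + 1/2)\<^sup>2 + \<delta>)"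

definition wp_family :: "nat \<Rightarrow> nat \<Rightarrow> real \<Rightarrow> real" where
  "wp_family n k x = (1 + \<kappa> * x) *
     cubic_wp_term (cubic x) (1 + \<alpha> * x) (1/2 + \<epsilon> * x) (1 + (2 * \<alpha> - \<epsilon> - \<beta>) * x) n k"

definition wp_logderiv :: "nat \<Rightarrow> nat \<Rightarrow> real" where
  "wp_logderiv n k = \<kappa>
     + (\<Sum>j<n + k. (\<beta> / (real j + 1/2) + \<delta> / (real j + 1/2) ^ 3)
                 - ((3 * \<alpha> - \<beta>) / (real j + 3/2) - \<delta> / (real j + 3/2) ^ 3))
     + (\<Sum>j<n. (\<alpha> - 2 * \<epsilon>) / (real j + 1) - \<delta> / (real j + 1) ^ 3)
     + (\<Sum>j<k. \<epsilon> / (real j + 1/2)) - (\<Sum>j<2 * n + k. (\<alpha> - \<epsilon>) / (real j + 3/2))"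

lemma has_logderiv_cubic: "has_logderiv (\<lambda>x. cubic x (real j)) (\<beta> / (real j + 1/2) + \<delta> / (real j + 1/2) ^ 3) 0"
proof (rule has_logderivI)
  show "((\<lambda>x. cubic x (real j)) has_field_derivative \<beta> * (real j + 1/2)\<^sup>2 + \<delta>) (at 0)"
    unfolding cubic_def by (auto intro!: derivative_eq_intros)
qed (auto simp: cubic_def divide_simps power2_eq_square power3_eq_cube, algebra)

lemma has_logderiv_cubic_reflected:
  assumes "h = real j + 3/2"
  shows "has_logderiv (\<lambda>x. - cubic x (- 1 - (1 + \<alpha> * x) - real j)) ((3 * \<alpha> - \<beta>) / h - \<delta> / h ^ 3) 0"
proof (rule has_logderivI)
  show "((\<lambda>x. - cubic x (- 1 - (1 + \<alpha> * x) - real j)) has_field_derivative (3 * \<alpha> - \<beta>) * h ^ 2 - \<delta>) (at 0)"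
    unfolding cubic_def assms
    by (auto intro!: derivative_eq_intros simp: power2_eq_square) (simp add: field_simps)
qed (auto simp: cubic_def assms divide_simps power2_eq_square power3_eq_cube, algebra)


lemma has_logderiv_wp_family: "has_logderiv (wp_family n k) (wp_logderiv n k) 0"
proof -
  have K: "has_logderiv (\<lambda>x. 1 + \<kappa> * x) \<kappa> 0"
    by (rule has_logderivI) (auto intro!: derivative_eq_intros)
  have P1: "has_logderiv (\<lambda>x. \<Prod>j<n + k. cubic x (real j) / - cubic x (- 1 - (1 + \<alpha> * x) - real j))
     (\<Sum>j<n + k. (\<beta> / (real j + 1/2) + \<delta> / (real j + 1/2) ^ 3)
                 - ((3 * \<alpha> - \<beta>) / (real j + 3/2) - \<delta> / (real j + 3/2) ^ 3)) 0"
    by (intro has_logderiv_prod has_logderiv_divide has_logderiv_cubic has_logderiv_cubic_reflected refl)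
       (simp add: cubic_def; linarith)
  have P2: "has_logderiv (\<lambda>x. \<Prod>j<n. - cubic x (- (1 + (1 + \<alpha> * x) - (1/2 + \<epsilon> * x) + real j))
                                    / ((1 + (2 * \<alpha> - \<epsilon> - \<beta>) * x) + real j))
     (\<Sum>j<n. (\<alpha> - 2 * \<epsilon>) / (real j + 1) - \<delta> / (real j + 1) ^ 3) 0"
  proof (intro has_logderiv_prod)
    fix j
    define h where "h = real j + 1"
    have h: "h \<noteq> 0" "h > 0" by (auto simp: h_def)
    have 1: "has_logderiv (\<lambda>x. - cubic x (- (1 + (1 + \<alpha> * x) - (1/2 + \<epsilon> * x) + real j)))
       ((3 * (\<alpha> - \<epsilon>) - \<beta>) / h - \<delta> / h ^ 3) 0"
    proof (rule has_logderivI)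
      show "((\<lambda>x. - cubic x (- (1 + (1 + \<alpha> * x) - (1/2 + \<epsilon> * x) + real j)))
         has_field_derivative (3 * (\<alpha> - \<epsilon>) - \<beta>) * h ^ 2 - \<delta>) (at 0)"
        unfolding cubic_def h_def
        by (auto intro!: derivative_eq_intros simp: power2_eq_square) (simp add: field_simps)
      have v: "- cubic 0 (- (1 + (1 + \<alpha> * 0) - (1/2 + \<epsilon> * 0) + real j)) = h ^ 3"
        by (simp add: cubic_def h_def algebra_simps power3_eq_cube)
      show "- cubic 0 (- (1 + (1 + \<alpha> * 0) - (1/2 + \<epsilon> * 0) + real j)) \<noteq> 0"
        unfolding v using h by simp
      show "(3 * (\<alpha> - \<epsilon>) - \<beta>) / h - \<delta> / h ^ 3 = ((3 * (\<alpha> - \<epsilon>) - \<beta>) * h ^ 2 - \<delta>)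
         / - cubic 0 (- (1 + (1 + \<alpha> * 0) - (1/2 + \<epsilon> * 0) + real j))"
        unfolding v using h by (simp add: divide_simps power2_eq_square power3_eq_cube)
    qed
    have 2: "has_logderiv (\<lambda>x. (1 + (2 * \<alpha> - \<epsilon> - \<beta>) * x) + real j) ((2 * \<alpha> - \<epsilon> - \<beta>) / h) 0"
      by (rule has_logderivI) (auto intro!: derivative_eq_intros simp: h_def add_ac)
    have 3: "(3 * (\<alpha> - \<epsilon>) - \<beta>) / h - \<delta> / h ^ 3 - (2 * \<alpha> - \<epsilon> - \<beta>) / h
        = (\<alpha> - 2 * \<epsilon>) / h - \<delta> / h ^ 3"
      using h by (simp add: divide_simps) algebra
    show "has_logderiv (\<lambda>x. - cubic x (- (1 + (1 + \<alpha> * x) - (1/2 + \<epsilon> * x) + real j))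
                                    / ((1 + (2 * \<alpha> - \<epsilon> - \<beta>) * x) + real j))
       ((\<alpha> - 2 * \<epsilon>) / (real j + 1) - \<delta> / (real j + 1) ^ 3) 0"
      using has_logderiv_divide[OF 1 2] h unfolding 3 by (simp add: h_def add_ac)
  qed
  have P3: "has_logderiv (\<lambda>x. \<Prod>j<k. 1/2 + \<epsilon> * x + real j) (\<Sum>j<k. \<epsilon> / (real j + 1/2)) 0"
    by (intro has_logderiv_prod, rule has_logderivI) (auto intro!: derivative_eq_intros simp: add_ac)
  have P4: "has_logderiv (\<lambda>x. \<Prod>j<2 * n + k. 1 + (1 + \<alpha> * x) - (1/2 + \<epsilon> * x) + real j)
      (\<Sum>j<2 * n + k. (\<alpha> - \<epsilon>) / (real j + 3/2)) 0"
    by (intro has_logderiv_prod, rule has_logderivI) (auto intro!: derivative_eq_intros simp: add_ac)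
  have nz: "(\<Prod>j<2 * n + k. 1 + (1 + \<alpha> * 0) - (1/2 + \<epsilon> * 0) + real j) \<noteq> 0"
    by (auto simp: add_pos_nonneg)
  show ?thesis
    unfolding wp_family_def[abs_def] wp_logderiv_def cubic_wp_term_def
    using has_logderiv_mult[OF K has_logderiv_divide[OF has_logderiv_mult[OF has_logderiv_mult[OF
        has_logderiv_mult[OF has_logderiv_const P1] P2] P3] P4 nz]]
    by (simp add: add_diff_eq add.assoc)
qed

end

text \<open>
  The part of the unperturbed term that makes the accelerated series converge geometrically; it equals
  \<open>(n!)\<^sup>2 (1/2)\<^sub>k / (3/2)\<^sub>2\<^sub>n\<^sub>+\<^sub>k\<close> in Pochhammer symbols.
\<close>
definition decay :: "nat \<Rightarrow> nat \<Rightarrow> real" where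
  "decay n k = (\<Prod>j<n. (real j + 1)\<^sup>2) * (\<Prod>j<k. real j + 1/2) / (\<Prod>j<2 * n + k. real j + 3/2)"

definition base_F :: "nat \<Rightarrow> nat \<Rightarrow> real" where
  "base_F n k = (-1) ^ n * decay n k / (2 * real (n + k) + 1)\<^sup>2"

definition base_M :: "nat \<Rightarrow> nat \<Rightarrow> real" where
  "base_M n k = (-1) ^ n * decay n k / (8 * (real (2 * n + k) + 3/2) * (real n + 1))"

context direction
begin

lemma wp_family_0: "wp_family n k 0 = (-1) ^ n * decay n k / (2 * real (n + k) + 1) ^ 3"
proof -
  have 1: "(\<Prod>j<m. cubic 0 (real j) / - cubic 0 (- 1 - 1 - real j)) = 1 / (2 * real m + 1) ^ 3" for m
  proof (induction m)
    case (Suc m)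
    have c: "cubic 0 (real m) = (2 * real m + 1) ^ 3 / 8"
      "cubic 0 (- 1 - 1 - real m) = - ((2 * real m + 3) ^ 3 / 8)"
      by (auto simp: cubic_def power3_eq_cube field_simps)
    have "2 * real m + 1 \<noteq> 0" "2 * real (Suc m) + 1 = 2 * real m + 3" by (linarith, simp)
    thus ?case unfolding prod.lessThan_Suc Suc c by (simp add: add.commute)
  qed auto
  have 2: "(\<Prod>j<n. - cubic 0 (- (1 + 1 - 1/2 + real j)) / (1 + real j)) = (\<Prod>j<n. (real j + 1)\<^sup>2)"
  proof (rule prod.cong)
    fix j
    have cub: "- cubic 0 (- (1 + 1 - 1/2 + real j)) = (real j + 1) ^ 3"
      by (simp add: cubic_def algebra_simps power3_eq_cube)
    have "1 + real j = real j + 1" "real j + 1 \<noteq> 0" by auto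
    thus "- cubic 0 (- (1 + 1 - 1/2 + real j)) / (1 + real j) = (real j + 1)\<^sup>2"
      unfolding cub by (simp only: power3_eq_cube power2_eq_square nonzero_mult_div_cancel_right not_False_eq_True)
  qed auto
  have 3: "(\<Prod>j<m. 1 + 1 - 1/2 + real j) = (\<Prod>j<m. real j + 3/2)" for m
    by (rule prod.cong) auto
  have 4: "(\<Prod>j<k. 1/2 + real j) = (\<Prod>j<k. real j + 1/2)"
    by (rule prod.cong) auto
  have "wp_family n k 0 = (-1) ^ n * (\<Prod>j<n + k. cubic 0 (real j) / - cubic 0 (- 1 - 1 - real j))
     * (\<Prod>j<n. - cubic 0 (- (1 + 1 - 1/2 + real j)) / (1 + real j))
     * (\<Prod>j<k. 1/2 + real j) / (\<Prod>j<2 * n + k. 1 + 1 - 1/2 + real j)"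
    unfolding wp_family_def cubic_wp_term_def mult_zero_right add_0_right mult_1_left ..
  thus ?thesis unfolding 1 2 3 4 decay_def by (simp add: mult_ac)
qed

text \<open>
  \<open>dF\<close> and \<open>dM\<close> are the derivatives at \<open>x = 0\<close> of the two members of the Wilf--Zeilberger pair along the
  family, so the recurrence between \<open>F\<close> and \<open>M\<close> passes to them.
\<close>
definition dF :: "nat \<Rightarrow> nat \<Rightarrow> real" where
  "dF n k = base_F n k * (wp_logderiv n k + \<alpha> / (2 * real (n + k) + 1))"

definition dM :: "nat \<Rightarrow> nat \<Rightarrow> real" where
  "dM n k = base_M n k * (wp_logderiv n k + \<beta> / (real (n + k) + 1/2) + \<delta> / (real (n + k) + 1/2) ^ 3
     - (\<alpha> - \<epsilon>) / (real (2 * n + k) + 3/2) - (2 * \<alpha> - \<epsilon> - \<beta>) / (real n + 1))"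

lemma has_derivative_dF: "((\<lambda>x. (1 + \<alpha> * x + 2 * real n + 2 * real k) * wp_family n k x) has_field_derivative dF n k) (at 0)"
proof -
  have 1: "has_logderiv (\<lambda>x. 1 + \<alpha> * x + 2 * real n + 2 * real k) (\<alpha> / (2 * real (n + k) + 1)) 0"
    by (rule has_logderivI) (auto intro!: derivative_eq_intros)
  have 2: "(1 + \<alpha> * 0 + 2 * real n + 2 * real k) * wp_family n k 0 = base_F n k"
  proof -
    define u where "u = 2 * real (n + k) + 1"
    have u: "u \<noteq> 0" "1 + \<alpha> * 0 + 2 * real n + 2 * real k = u" unfolding u_def by (linarith, simp)
    thus ?thesis
      unfolding wp_family_0 base_F_def u_def [symmetric] u(2)
      by (simp add: power2_eq_square power3_eq_cube)
  qed
  show ?thesis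
    using has_logderiv_mult[OF 1 has_logderiv_wp_family[of n k]]
    unfolding has_logderiv_def 2 by (simp add: dF_def add.commute)
qed

lemma has_derivative_dM:
  "((\<lambda>x. wp_family n k x * cubic x (real (n + k))
       / ((1 + (1 + \<alpha> * x) - (1/2 + \<epsilon> * x) + real (2 * n + k)) * ((1 + (2 * \<alpha> - \<epsilon> - \<beta>) * x) + real n)))
     has_field_derivative dM n k) (at 0)"
proof -
  have 1: "has_logderiv (\<lambda>x. 1 + (1 + \<alpha> * x) - (1/2 + \<epsilon> * x) + real (2 * n + k))
      ((\<alpha> - \<epsilon>) / (real (2 * n + k) + 3/2)) 0"
    by (rule has_logderivI) (auto intro!: derivative_eq_intros)
  have 2: "has_logderiv (\<lambda>x. (1 + (2 * \<alpha> - \<epsilon> - \<beta>) * x) + real n) ((2 * \<alpha> - \<epsilon> - \<beta>) / (real n + 1)) 0"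
    by (rule has_logderivI) (auto intro!: derivative_eq_intros)
  have nz: "(1 + (1 + \<alpha> * 0) - (1/2 + \<epsilon> * 0) + real (2 * n + k)) * ((1 + (2 * \<alpha> - \<epsilon> - \<beta>) * 0) + real n) \<noteq> 0"
    by simp
  have 3: "wp_family n k 0 * cubic 0 (real (n + k))
       / ((1 + (1 + \<alpha> * 0) - (1/2 + \<epsilon> * 0) + real (2 * n + k)) * ((1 + (2 * \<alpha> - \<epsilon> - \<beta>) * 0) + real n)) = base_M n k"
  proof -
    have c: "cubic 0 (real (n + k)) = (2 * real (n + k) + 1) ^ 3 / 8"
      by (auto simp: cubic_def power3_eq_cube field_simps)
    have "(2 * real (n + k) + 1) ^ 3 \<noteq> 0"
      by (simp del: of_nat_add)
    thus ?thesis unfolding c wp_family_0 base_M_def by (simp add: add_ac mult_ac)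
  qed
  show ?thesis
    using has_logderiv_divide[OF has_logderiv_mult[OF has_logderiv_wp_family[of n k] has_logderiv_cubic[of "n + k"]]
        has_logderiv_mult[OF 1 2] nz]
    unfolding has_logderiv_def 3 by (simp only: dM_def diff_diff_eq add.assoc)
qed

text \<open>
  The recurrence needs four non-vanishing denominators. They do not vanish at \<open>x = 0\<close>, hence not for small
  \<open>x\<close> either, and this is enough to differentiate.
\<close>
lemma dF_dM_WZ: "dF (Suc n) k - dF n (Suc k) = dM n (Suc k) - dM n k"
proof -
  \<comment> \<open>The two members of the pair as functions of the perturbation parameter.\<close>
  let ?F = "\<lambda>n k x. (1 + \<alpha> * x + 2 * real n + 2 * real k) * wp_family n k x"
  let ?M = "\<lambda>n k x. wp_family n k x * cubic x (real (n + k))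
       / ((1 + (1 + \<alpha> * x) - (1/2 + \<epsilon> * x) + real (2 * n + k)) * ((1 + (2 * \<alpha> - \<epsilon> - \<beta>) * x) + real n))"
  have F: "((\<lambda>x. ?F (Suc n) k x - ?F n (Suc k) x) has_field_derivative dF (Suc n) k - dF n (Suc k)) (at 0)"
    by (rule DERIV_diff[OF has_derivative_dF has_derivative_dF])
  have M: "((\<lambda>x. ?M n (Suc k) x - ?M n k x) has_field_derivative dM n (Suc k) - dM n k) (at 0)"
    by (rule DERIV_diff[OF has_derivative_dM has_derivative_dM])
  have nonzero: "\<forall>\<^sub>F x in nhds 0. g x \<noteq> 0" if "isCont g 0" "g 0 \<noteq> 0" for g :: "real \<Rightarrow> real"
  proof -
    have "\<forall>\<^sub>F x in at 0. g x \<noteq> 0"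
      using that by (intro tendsto_imp_eventually_ne[of g "g 0"]) (auto simp: isCont_def)
    thus ?thesis using that(2) by (auto simp: eventually_at_filter elim: eventually_mono)
  qed
  have "\<forall>\<^sub>F x in nhds 0. cubic x (- 1 - (1 + \<alpha> * x) - real (n + k)) \<noteq> 0"
    by (rule nonzero) (auto simp: cubic_def intro!: continuous_intros)
  moreover have "\<forall>\<^sub>F x in nhds 0. (1 + (2 * \<alpha> - \<epsilon> - \<beta>) * x) + real n \<noteq> 0"
    by (rule nonzero) (auto intro!: continuous_intros)
  moreover have "\<forall>\<^sub>F x in nhds 0. 1 + (1 + \<alpha> * x) - (1/2 + \<epsilon> * x) + real (2 * n + k) \<noteq> 0"
    by (rule nonzero) (auto intro!: continuous_intros)
  moreover have "\<forall>\<^sub>F x in nhds 0. 1 + (1 + \<alpha> * x) - (1/2 + \<epsilon> * x) + real (2 * n + k + 1) \<noteq> 0"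
    by (rule nonzero) (auto intro!: continuous_intros)
  ultimately have ev: "\<forall>\<^sub>F x in nhds 0. ?M n (Suc k) x - ?M n k x = ?F (Suc n) k x - ?F n (Suc k) x"
  proof eventually_elim
    case (elim x)
    have cub: "cubic x t = t ^ 3 + (3/2 + \<beta> * x) * t\<^sup>2 + (3/4 + \<beta> * x) * t + (1/8 + x * (\<beta>/4 + \<delta>))" for t
      by (simp add: cubic_def power2_eq_square power3_eq_cube field_simps)
    \<comment> \<open>The value of \<open>\<sigma>\<close> is forced by the coefficient \<open>3/2 + \<beta> * x\<close> of the square in the cubic.\<close>
    have sig: "1 + (2 * \<alpha> - \<epsilon> - \<beta>) * x = 1 + 2 * (1 + \<alpha> * x) - (1/2 + \<epsilon> * x) - (3/2 + \<beta> * x)"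
      by (simp add: algebra_simps)
    have scale: "A * t1 - B * t2 = t2 * p / q - t3 * r / s
        \<Longrightarrow> (c * t2) * p / q - (c * t3) * r / s = A * (c * t1) - B * (c * t2)"
      for A B t1 t2 t3 p q r s c :: real
    proof -
      assume "A * t1 - B * t2 = t2 * p / q - t3 * r / s"
      hence "c * (A * t1 - B * t2) = c * (t2 * p / q - t3 * r / s)" by simp
      thus ?thesis by (simp add: algebra_simps)
    qed
    note WZ = cubic_wp_term_WZ[OF cub sig elim]
    show ?case
      unfolding wp_family_def by (rule scale[OF WZ])
  qed
  have "((\<lambda>x. ?F (Suc n) k x - ?F n (Suc k) x) has_field_derivative dM n (Suc k) - dM n k) (at 0)"
    by (rule iffD1[OF DERIV_cong_ev[OF refl ev refl] M])
  thus ?thesis by (rule DERIV_unique[OF F])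
qed

end

section \<open>Letting the boundary terms vanish\<close>

lemma decay_pos: "decay n k > 0"
  unfolding decay_def by (intro divide_pos_pos mult_pos_pos prod_pos) auto

lemma decay_Suc: "decay (Suc n) k = decay n k * ((real n + 1)\<^sup>2
    / ((real (2 * n + k) + 3/2) * (real (2 * n + k) + 5/2)))"
proof -
  have idx: "2 * Suc n + k = Suc (Suc (2 * n + k))" by simp
  have "real (Suc (2 * n + k)) + 3/2 = real (2 * n + k) + 5/2" by simp
  thus ?thesis unfolding decay_def idx prod.lessThan_Suc by (simp add: mult_ac add_ac)
qed

lemma decay_0: "decay 0 k = 1 / (2 * real k + 1)"
proof (induction k)
  case (Suc k)
  have "decay 0 (Suc k) = decay 0 k * ((real k + 1/2) / (real k + 3/2))"
    by (simp add: decay_def)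
  also have "\<dots> = 1 / (2 * real (Suc k) + 1)"
  proof -
    have e: "real k + 1/2 = (2 * real k + 1) / 2" "real k + 3/2 = (2 * real (Suc k) + 1) / 2"
      by (simp_all add: field_simps)
    have cancel: "u \<noteq> 0 \<Longrightarrow> 1 / u * (u / 2 / (v / 2)) = 1 / v" for u v :: real
      by simp
    show ?thesis unfolding Suc e by (rule cancel) linarith
  qed
  finally show ?case .
qed (simp add: decay_def)

lemma decay_le: "decay n k \<le> 1 / (2 * real k + 1)"
proof (induction n)
  case (Suc n)
  have "(real n + 1) * (real n + 1) \<le> (real (2 * n + k) + 3/2) * (real (2 * n + k) + 5/2)"
    by (intro mult_mono) auto
  hence "(real n + 1)\<^sup>2 / ((real (2 * n + k) + 3/2) * (real (2 * n + k) + 5/2)) \<le> 1"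
    by (simp add: power2_eq_square)
  hence "decay (Suc n) k \<le> decay n k"
    unfolding decay_Suc by (intro mult_left_le less_imp_le[OF decay_pos])
  thus ?case using Suc by simp
qed (simp add: decay_0)

text \<open>
  The boundary of the square \<open>{..<N} \<times> {..<N}\<close> carries \<open>O(N)\<close> terms, so a bound of order
  \<open>1 / N\<^sup>2\<close> for each of them, up to a logarithm, makes their sum vanish. This crude bound uses only that
  \<open>decay\<close> is at most \<open>1 / (2 k + 1)\<close>.
\<close>
lemma abs_base_F_le:
  assumes "N \<le> n + k"
  shows "\<bar>base_F n k\<bar> \<le> 1 / (real N + 1)\<^sup>2"
proof -
  have "\<bar>base_F n k\<bar> = decay n k / (2 * real (n + k) + 1)\<^sup>2"
    using decay_pos[of n k] by (simp add: base_F_def abs_mult)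
  also have "\<dots> \<le> 1 / (real N + 1)\<^sup>2"
  proof (intro frac_le power_mono)
    have "1 / (2 * real k + 1) \<le> 1" by simp
    thus "decay n k \<le> 1" using decay_le[of n k] by linarith
  qed (use assms in auto)
  finally show ?thesis .
qed

lemma abs_base_M_le: "\<bar>base_M n k\<bar> \<le> 1 / (real k + 1)\<^sup>2"
proof -
  have "\<bar>base_M n k\<bar> = decay n k / (8 * (real (2 * n + k) + 3/2) * (real n + 1))"
    using decay_pos[of n k] by (simp add: base_M_def abs_mult)
  also have "\<dots> \<le> (1 / (2 * real k + 1)) / (8 * (real (2 * n + k) + 3/2) * 1)"
    by (intro frac_le mult_left_mono decay_le) auto
  also have "\<dots> = 1 / ((2 * real k + 1) * (8 * (real (2 * n + k) + 3/2)))"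
    by simp
  also have "\<dots> \<le> 1 / (real k + 1)\<^sup>2"
    unfolding power2_eq_square by (intro divide_left_mono mult_mono mult_pos_pos) auto
  finally show ?thesis .
qed

lemma abs_sum_le_harm:
  fixes f :: "nat \<Rightarrow> real"
  assumes "\<And>j. \<bar>f j\<bar> \<le> C / (real j + 1)" "m \<le> M"
  shows "\<bar>\<Sum>j<m. f j\<bar> \<le> C * harm M"
proof -
  have "0 \<le> \<bar>f 0\<bar>" by simp
  also have "\<dots> \<le> C" using assms(1)[of 0] by simp
  finally have C: "C \<ge> 0" .
  have "\<bar>\<Sum>j<m. f j\<bar> \<le> (\<Sum>j<m. C / (real j + 1))"
    by (intro sum_abs[THEN order_trans] sum_mono assms)
  also have "\<dots> = C * harm m"
    by (simp add: harm_altdef sum_distrib_left divide_inverse add.commute)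
  also have "\<dots> \<le> C * harm M"
    by (intro mult_left_mono harm_mono assms C)
  finally show ?thesis .
qed

lemma abs_add_add_diff_diff_le:
  fixes a b c d e :: real
  assumes "\<bar>a\<bar> \<le> A" "\<bar>b\<bar> \<le> B" "\<bar>c\<bar> \<le> C" "\<bar>d\<bar> \<le> D" "\<bar>e\<bar> \<le> E"
  shows "\<bar>a + b + c - d - e\<bar> \<le> A + B + C + D + E"
  using assms unfolding abs_le_iff by linarith

lemma abs_add_add_add_diff_le:
  fixes a b c d e :: real
  assumes "\<bar>a\<bar> \<le> A" "\<bar>b\<bar> \<le> B" "\<bar>c\<bar> \<le> C" "\<bar>d\<bar> \<le> D" "\<bar>e\<bar> \<le> E"
  shows "\<bar>a + b + c + d - e\<bar> \<le> A + B + C + D + E"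
  using assms unfolding abs_le_iff by linarith

lemma harm_Suc_le_ln: "harm (Suc n) \<le> 1 + ln (real (Suc n))"
  using decseqD[OF decseq_harm_diff_ln, of 0 n] by (simp add: harm_expand)

context direction
begin

definition magnitude :: real where
  "magnitude = \<bar>\<alpha>\<bar> + \<bar>\<beta>\<bar> + \<bar>\<epsilon>\<bar> + \<bar>\<delta>\<bar>"

lemma abs_wp_logderiv_le: "\<bar>wp_logderiv n k\<bar> \<le> \<bar>\<kappa>\<bar> + 14 * magnitude * harm (2 * n + k)"
proof -
  \<comment> \<open>Every summand is compared with a multiple of \<open>1 / (j + 1)\<close>; \<open>1 / (j + 1/2)\<close> costs a factor \<open>q = 2\<close>.\<close>
  have r: "\<bar>c / (real j + d)\<bar> \<le> \<bar>c\<bar> * q / (real j + 1)"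
     "\<bar>c / (real j + d) ^ 3\<bar> \<le> \<bar>c\<bar> * q ^ 3 / (real j + 1)"
    if dq: "d > 0" "q > 0" "d * q \<ge> 1" "q \<ge> 1" for c d q :: real and j
  proof -
    have b: "real j + 1 \<le> (real j + d) * q"
      using dq mult_left_mono[of 1 q "real j"] by (simp add: algebra_simps)
    have 1: "1 / (real j + d) \<le> q / (real j + 1)"
      using b dq by (simp add: divide_simps mult_ac add_pos_nonneg)
    have "1 / (real j + d) ^ 3 = (1 / (real j + d)) ^ 3" by (simp add: power_divide)
    also have "\<dots> \<le> (q / (real j + 1)) ^ 3"
      using 1 dq by (intro power_mono) auto
    also have "\<dots> = q ^ 3 / (real j + 1) ^ 3" by (simp add: power_divide)
    also have "\<dots> \<le> q ^ 3 / (real j + 1)"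
      using dq by (intro divide_left_mono self_le_power mult_pos_pos zero_less_power) auto
    finally have 2: "1 / (real j + d) ^ 3 \<le> q ^ 3 / (real j + 1)" .
    show "\<bar>c / (real j + d)\<bar> \<le> \<bar>c\<bar> * q / (real j + 1)"
      using mult_left_mono[OF 1, of "\<bar>c\<bar>"] dq by (simp add: abs_divide)
    show "\<bar>c / (real j + d) ^ 3\<bar> \<le> \<bar>c\<bar> * q ^ 3 / (real j + 1)"
      using mult_left_mono[OF 2, of "\<bar>c\<bar>"] dq by (simp add: abs_divide)
  qed
  have mono: "x1 \<le> x2 \<Longrightarrow> x1 / (real j + 1) \<le> x2 / (real j + 1)" for x1 x2 :: real and j
    by (simp add: divide_right_mono)
  have b1: "\<bar>\<Sum>j<n + k. (\<beta> / (real j + 1/2) + \<delta> / (real j + 1/2) ^ 3)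
                 - ((3 * \<alpha> - \<beta>) / (real j + 3/2) - \<delta> / (real j + 3/2) ^ 3)\<bar> \<le> 9 * magnitude * harm (2 * n + k)"
  proof (rule abs_sum_le_harm)
    fix j
    have "\<bar>(\<beta> / (real j + 1/2) + \<delta> / (real j + 1/2) ^ 3) - ((3 * \<alpha> - \<beta>) / (real j + 3/2) - \<delta> / (real j + 3/2) ^ 3)\<bar>
       \<le> (\<bar>\<beta>\<bar> * 2 + \<bar>\<delta>\<bar> * 2 ^ 3 + \<bar>3 * \<alpha> - \<beta>\<bar> * 1 + \<bar>\<delta>\<bar> * 1 ^ 3) / (real j + 1)"
      unfolding add_divide_distrib
      by (intro order_trans[OF abs_triangle_ineq4] order_trans[OF add_mono[OF abs_triangle_ineq abs_triangle_ineq4]]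
            order_trans[OF _ eq_refl[OF add.assoc[symmetric]]] add_mono r) auto
    also have "\<dots> \<le> 9 * magnitude / (real j + 1)"
      by (rule mono) (simp add: magnitude_def)
    finally show "\<bar>(\<beta> / (real j + 1/2) + \<delta> / (real j + 1/2) ^ 3) - ((3 * \<alpha> - \<beta>) / (real j + 3/2) - \<delta> / (real j + 3/2) ^ 3)\<bar>
       \<le> 9 * magnitude / (real j + 1)" .
  qed auto
  have b2: "\<bar>\<Sum>j<n. (\<alpha> - 2 * \<epsilon>) / (real j + 1) - \<delta> / (real j + 1) ^ 3\<bar> \<le> 2 * magnitude * harm (2 * n + k)"
  proof (rule abs_sum_le_harm)
    fix j
    have "\<bar>(\<alpha> - 2 * \<epsilon>) / (real j + 1) - \<delta> / (real j + 1) ^ 3\<bar>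
       \<le> (\<bar>\<alpha> - 2 * \<epsilon>\<bar> * 1 + \<bar>\<delta>\<bar> * 1 ^ 3) / (real j + 1)"
      unfolding add_divide_distrib
      by (intro order_trans[OF abs_triangle_ineq4] add_mono r) auto
    also have "\<dots> \<le> 2 * magnitude / (real j + 1)"
      by (rule mono) (simp add: magnitude_def)
    finally show "\<bar>(\<alpha> - 2 * \<epsilon>) / (real j + 1) - \<delta> / (real j + 1) ^ 3\<bar> \<le> 2 * magnitude / (real j + 1)" .
  qed auto
  have b3: "\<bar>\<Sum>j<k. \<epsilon> / (real j + 1/2)\<bar> \<le> 2 * magnitude * harm (2 * n + k)"
  proof (rule abs_sum_le_harm)
    fix j
    have "\<bar>\<epsilon>\<bar> * 2 / (real j + 1) \<le> 2 * magnitude / (real j + 1)"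
      by (rule mono) (simp add: magnitude_def)
    thus "\<bar>\<epsilon> / (real j + 1/2)\<bar> \<le> 2 * magnitude / (real j + 1)"
      using r(1)[of "1/2" 2 \<epsilon> j] by linarith
  qed auto
  have b4: "\<bar>\<Sum>j<2 * n + k. (\<alpha> - \<epsilon>) / (real j + 3/2)\<bar> \<le> magnitude * harm (2 * n + k)"
  proof (rule abs_sum_le_harm)
    fix j
    have "\<bar>\<alpha> - \<epsilon>\<bar> * 1 / (real j + 1) \<le> magnitude / (real j + 1)"
      by (rule mono) (simp add: magnitude_def)
    thus "\<bar>(\<alpha> - \<epsilon>) / (real j + 3/2)\<bar> \<le> magnitude / (real j + 1)"
      using r(1)[of "3/2" 1 "\<alpha> - \<epsilon>" j] by linarith
  qed auto
  show ?thesis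
    unfolding wp_logderiv_def
    by (rule order_trans[OF abs_add_add_add_diff_le[OF order_refl b1 b2 b3 b4]]) (simp add: algebra_simps)
qed

text \<open>
  A common bound for the logarithmic derivatives of all boundary terms of the square of side \<open>N\<close>.
\<close>
definition growth :: "nat \<Rightarrow> real" where
  "growth N = \<bar>\<kappa>\<bar> + 16 * magnitude + 14 * magnitude * harm (3 * N)"

lemma abs_dF_le:
  assumes "N \<le> n + k" "n \<le> N" "k \<le> N"
  shows "\<bar>dF n k\<bar> \<le> growth N / (real N + 1)\<^sup>2"
proof -
  have "\<bar>\<alpha> / (2 * real (n + k) + 1)\<bar> \<le> \<bar>\<alpha>\<bar> / 1"
    unfolding abs_divide by (intro frac_le) auto
  also have "\<dots> \<le> 16 * magnitude" by (simp add: magnitude_def)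
  finally have "\<bar>\<alpha> / (2 * real (n + k) + 1)\<bar> \<le> 16 * magnitude" .
  moreover have "14 * magnitude * harm (2 * n + k) \<le> 14 * magnitude * harm (3 * N)"
    using assms by (intro mult_left_mono harm_mono) (auto simp: magnitude_def)
  ultimately have "\<bar>wp_logderiv n k + \<alpha> / (2 * real (n + k) + 1)\<bar>
      \<le> (\<bar>\<kappa>\<bar> + 14 * magnitude * harm (3 * N)) + 16 * magnitude"
    using abs_wp_logderiv_le[of n k]
    by (intro order_trans[OF abs_triangle_ineq] add_mono) (auto intro: order_trans)
  hence "\<bar>wp_logderiv n k + \<alpha> / (2 * real (n + k) + 1)\<bar> \<le> growth N"
    unfolding growth_def by (simp only: add_ac)
  hence "\<bar>dF n k\<bar> \<le> (1 / (real N + 1)\<^sup>2) * growth N"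
    unfolding dF_def abs_mult by (intro mult_mono abs_base_F_le assms) auto
  thus ?thesis by simp
qed

lemma abs_dM_le:
  assumes "n \<le> N"
  shows "\<bar>dM n N\<bar> \<le> growth N / (real N + 1)\<^sup>2"
proof -
  have q: "\<bar>c / d\<bar> \<le> \<bar>c\<bar> * q" if "d > 0" "d * q \<ge> 1" for c d q :: real
  proof -
    have "1 / d \<le> q" using that by (simp add: divide_simps mult_ac)
    from mult_left_mono[OF this, of "\<bar>c\<bar>"] show ?thesis using that by (simp add: abs_divide)
  qed
  have "(1/2) ^ 3 \<le> (real (n + N) + 1/2) ^ 3" by (intro power_mono) auto
  hence "1 \<le> (real (n + N) + 1/2) ^ 3 * 8" by (simp add: power3_eq_cube)
  hence b3: "\<bar>\<delta> / (real (n + N) + 1/2) ^ 3\<bar> \<le> \<bar>\<delta>\<bar> * 8" by (intro q) auto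
  have b2: "\<bar>\<beta> / (real (n + N) + 1/2)\<bar> \<le> \<bar>\<beta>\<bar> * 2" by (intro q) auto
  have b4: "\<bar>(\<alpha> - \<epsilon>) / (real (2 * n + N) + 3/2)\<bar> \<le> \<bar>\<alpha> - \<epsilon>\<bar> * 1" by (intro q) auto
  have b5: "\<bar>(2 * \<alpha> - \<epsilon> - \<beta>) / (real n + 1)\<bar> \<le> \<bar>2 * \<alpha> - \<epsilon> - \<beta>\<bar> * 1" by (intro q) auto
  have "14 * magnitude * harm (2 * n + N) \<le> 14 * magnitude * harm (3 * N)"
    using assms by (intro mult_left_mono harm_mono) (auto simp: magnitude_def)
  hence b1: "\<bar>wp_logderiv n N\<bar> \<le> \<bar>\<kappa>\<bar> + 14 * magnitude * harm (3 * N)"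
    using abs_wp_logderiv_le[of n N] by (rule order_trans[rotated, OF add_left_mono])
  have c: "\<bar>\<beta>\<bar> * 2 + \<bar>\<delta>\<bar> * 8 + \<bar>\<alpha> - \<epsilon>\<bar> * 1 + \<bar>2 * \<alpha> - \<epsilon> - \<beta>\<bar> * 1 \<le> 16 * magnitude"
    by (simp add: magnitude_def)
  have "\<bar>wp_logderiv n N + \<beta> / (real (n + N) + 1/2) + \<delta> / (real (n + N) + 1/2) ^ 3
     - (\<alpha> - \<epsilon>) / (real (2 * n + N) + 3/2) - (2 * \<alpha> - \<epsilon> - \<beta>) / (real n + 1)\<bar> \<le> growth N"
    by (rule order_trans[OF abs_add_add_diff_diff_le[OF b1 b2 b3 b4 b5]])
       (use add_left_mono[OF c, of "\<bar>\<kappa>\<bar> + 14 * magnitude * harm (3 * N)"] in \<open>simp add: growth_def algebra_simps\<close>)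
  hence "\<bar>dM n N\<bar> \<le> (1 / (real N + 1)\<^sup>2) * growth N"
    unfolding dM_def abs_mult by (intro mult_mono abs_base_M_le) auto
  thus ?thesis by simp
qed

lemma acceleration_difference_tendsto_0:
  "(\<lambda>N. (\<Sum>n<N. dF n 0 + dM n 0) - (\<Sum>k<N. dF 0 k)) \<longlonglongrightarrow> 0"
proof (rule Lim_null_comparison)
  have "\<bar>(\<Sum>n<N. dF n 0 + dM n 0) - (\<Sum>k<N. dF 0 k)\<bar>
      \<le> 3 * real N * (growth N / (real N + 1)\<^sup>2)" (is "?l N \<le> ?r N") for N
  proof -
    let ?g = "growth N / (real N + 1)\<^sup>2"
    have "?l N = \<bar>(\<Sum>n<N. dF n N + dM n N) - (\<Sum>k<N. dF N k)\<bar>"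
      by (simp only: WZ_boundary_identity[of dF dM N N, OF dF_dM_WZ])
    also have "\<dots> \<le> \<bar>\<Sum>n<N. dF n N + dM n N\<bar> + \<bar>\<Sum>k<N. dF N k\<bar>"
      by (rule abs_triangle_ineq4)
    also have "\<dots> \<le> (\<Sum>n<N. ?g + ?g) + (\<Sum>k<N. ?g)"
    proof (intro add_mono order_trans[OF sum_abs] sum_mono)
      fix n assume "n \<in> {..<N}"
      thus "\<bar>dF n N + dM n N\<bar> \<le> ?g + ?g"
        by (intro order_trans[OF abs_triangle_ineq] add_mono abs_dF_le abs_dM_le) auto
    next
      fix k assume "k \<in> {..<N}"
      thus "\<bar>dF N k\<bar> \<le> ?g" by (intro abs_dF_le) auto
    qed
    also have "\<dots> = ?r N" by simp
    finally show ?thesis .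
  qed
  moreover have "?r N \<le> (3 * \<bar>\<kappa>\<bar> + 48 * magnitude) * (real N / (real N + 1)\<^sup>2)
      + 42 * magnitude * (real N * (1 + ln (real (Suc (3 * N)))) / (real N + 1)\<^sup>2)" for N
  proof -
    have "harm (3 * N) \<le> (harm (Suc (3 * N)) :: real)" by (intro harm_mono) simp
    also have "\<dots> \<le> 1 + ln (real (Suc (3 * N)))" by (rule harm_Suc_le_ln)
    finally have "growth N \<le> \<bar>\<kappa>\<bar> + 16 * magnitude + 14 * magnitude * (1 + ln (real (Suc (3 * N))))"
      unfolding growth_def by (intro add_left_mono mult_left_mono) (auto simp: magnitude_def)
    hence "?r N \<le> 3 * real N * ((\<bar>\<kappa>\<bar> + 16 * magnitude + 14 * magnitude * (1 + ln (real (Suc (3 * N))))) / (real N + 1)\<^sup>2)"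
      by (intro mult_left_mono divide_right_mono) auto
    also have "\<dots> = (3 * \<bar>\<kappa>\<bar> + 48 * magnitude) * (real N / (real N + 1)\<^sup>2)
      + 42 * magnitude * (real N * (1 + ln (real (Suc (3 * N)))) / (real N + 1)\<^sup>2)"
      by (simp add: divide_inverse algebra_simps)
    finally show ?thesis .
  qed
  ultimately show "\<forall>\<^sub>F N in sequentially. norm ((\<Sum>n<N. dF n 0 + dM n 0) - (\<Sum>k<N. dF 0 k))
      \<le> (3 * \<bar>\<kappa>\<bar> + 48 * magnitude) * (real N / (real N + 1)\<^sup>2)
        + 42 * magnitude * (real N * (1 + ln (real (Suc (3 * N)))) / (real N + 1)\<^sup>2)"
    unfolding real_norm_def by (intro always_eventually allI) (rule order_trans)
next
  have "(\<lambda>N. real N / (real N + 1)\<^sup>2) \<longlonglongrightarrow> 0" by real_asymp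
  moreover have "(\<lambda>N. real N * (1 + ln (real (Suc (3 * N)))) / (real N + 1)\<^sup>2) \<longlonglongrightarrow> 0" by real_asymp
  ultimately show "(\<lambda>N. (3 * \<bar>\<kappa>\<bar> + 48 * magnitude) * (real N / (real N + 1)\<^sup>2)
        + 42 * magnitude * (real N * (1 + ln (real (Suc (3 * N)))) / (real N + 1)\<^sup>2)) \<longlonglongrightarrow> 0"
    by (intro tendsto_add_zero tendsto_mult_right_zero)
qed

text \<open>
  The derivative in any direction of Dougall's series equals the derivative of its accelerated form.
\<close>
theorem acceleration:
  assumes "(\<lambda>N. \<Sum>k<N. dF 0 k) \<longlonglongrightarrow> L"
  shows "(\<lambda>N. \<Sum>n<N. dF n 0 + dM n 0) \<longlonglongrightarrow> L"
  using tendsto_add[OF acceleration_difference_tendsto_0 assms] by simp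

end

section \<open>The values of the limits\<close>

lemma sum_odd_inverse_powers_tendsto:
  assumes "(\<lambda>N. \<Sum>j<N. 1 / (real j + 1) ^ r) \<longlonglongrightarrow> Z"
  shows "(\<lambda>N. \<Sum>j<N. 1 / (2 * real j + 1) ^ r) \<longlonglongrightarrow> (1 - 1 / 2 ^ r) * Z"
proof -
  have split: "(\<Sum>j<N. 1 / (2 * real j + 1) ^ r)
      = (\<Sum>j<2 * N. 1 / (real j + 1) ^ r) - 1 / 2 ^ r * (\<Sum>j<N. 1 / (real j + 1) ^ r)" for N
  proof (induction N)
    case (Suc N)
    have idx: "2 * Suc N = Suc (Suc (2 * N))" by simp
    have "real (Suc (2 * N)) + 1 = 2 * (real N + 1)" by simp
    hence "1 / (real (Suc (2 * N)) + 1) ^ r = 1 / 2 ^ r * (1 / (real N + 1) ^ r)"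
      by (simp only: power_mult_distrib) simp
    thus ?case unfolding idx sum.lessThan_Suc Suc.IH by (simp add: algebra_simps)
  qed auto
  have "strict_mono (\<lambda>N :: nat. 2 * N)" by (simp add: strict_mono_def)
  from LIMSEQ_subseq_LIMSEQ[OF assms this]
  have "(\<lambda>N. \<Sum>j<2 * N. 1 / (real j + 1) ^ r) \<longlonglongrightarrow> Z" by (simp add: o_def)
  hence "(\<lambda>N. \<Sum>j<N. 1 / (2 * real j + 1) ^ r) \<longlonglongrightarrow> Z - 1 / 2 ^ r * Z"
    unfolding split by (intro tendsto_intros assms)
  thus ?thesis by (simp add: algebra_simps)
qed

lemma summable_inverse_power:
  "r \<ge> 2 \<Longrightarrow> summable (\<lambda>j. 1 / (real j + 1) ^ r)"
  using summable_Suc_iff[of "\<lambda>n. inverse (real n ^ r)"] inverse_power_summable[of r, where 'a = real]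
  by (simp add: divide_inverse add.commute)

lemma sum_inverse_cubes_tendsto: "(\<lambda>N. \<Sum>j<N. 1 / (real j + 1) ^ 3) \<longlonglongrightarrow> zeta (3::real)"
proof -
  have "zeta (3::real) = (\<Sum>j. 1 / (real j + 1) ^ 3)"
    unfolding zeta_def by (intro suminf_cong) (simp add: powr_numeral add.commute)
  thus ?thesis using summable_LIMSEQ[OF summable_inverse_power[of 3]] by simp
qed

text \<open>
  Euler's product for the sine on the imaginary axis.
\<close>
lemma sinh_product_formula_real:
  "(\<lambda>n. pi * x * (\<Prod>k=1..n. 1 + x\<^sup>2 / (real k)\<^sup>2)) \<longlonglongrightarrow> (exp (pi * x) - exp (- (pi * x))) / 2"
proof -
  have "(\<lambda>n. of_real pi * (\<i> * of_real x) * (\<Prod>k=1..n. 1 - (\<i> * of_real x)\<^sup>2 / (of_nat k)\<^sup>2))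
     \<longlonglongrightarrow> sin (of_real pi * (\<i> * of_real x))"
    by (rule sin_product_formula_complex)
  also have "(\<lambda>n. of_real pi * (\<i> * of_real x) * (\<Prod>k=1..n. 1 - (\<i> * of_real x)\<^sup>2 / (of_nat k)\<^sup>2))
     = (\<lambda>n. \<i> * of_real (pi * x * (\<Prod>k=1..n. 1 + x\<^sup>2 / (real k)\<^sup>2)))"
    by (simp add: power_mult_distrib mult_ac)
  finally have "(\<lambda>n. Im (\<i> * of_real (pi * x * (\<Prod>k=1..n. 1 + x\<^sup>2 / (real k)\<^sup>2))))
     \<longlonglongrightarrow> Im (sin (of_real pi * (\<i> * of_real x)))"
    by (rule tendsto_Im)
  also have "(\<lambda>n. Im (\<i> * of_real (pi * x * (\<Prod>k=1..n. 1 + x\<^sup>2 / (real k)\<^sup>2))))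
     = (\<lambda>n. pi * x * (\<Prod>k=1..n. 1 + x\<^sup>2 / (real k)\<^sup>2))"
    by (simp only: Im_i_times Re_complex_of_real)
  finally show ?thesis by (simp add: Im_sin)
qed

text \<open>
  Multiplying Euler's products for \<open>sin\<close> and \<open>sinh\<close> gives
  \<open>(\<Prod>j. 1 - x ^ 4 / (j + 1) ^ 4) = R x\<close> with \<open>R x = sin (pi x) sinh (pi x) / (pi x)\<^sup>2\<close>. If \<open>Z\<close> is the sum of
  the inverse fourth powers, telescoping the partial products bounds \<open>(1 - R x) / x ^ 4\<close> between
  \<open>Z * R x\<close> and \<open>Z\<close> for \<open>0 < x < 1\<close>. As \<open>x\<close> tends to 0, both bounds tend to \<open>Z\<close>, and the Taylor expansion of
  \<open>R\<close> gives \<open>pi ^ 4 / 90\<close> in the middle.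
\<close>
lemma sum_inverse_fourth_powers_tendsto: "(\<lambda>N. \<Sum>j<N. 1 / (real j + 1) ^ 4) \<longlonglongrightarrow> pi ^ 4 / 90"
proof -
  define S where "S = (\<lambda>N. \<Sum>j<N. 1 / (real j + 1) ^ 4)"
  define P where "P = (\<lambda>N x. \<Prod>j<N. 1 - x ^ 4 / (real j + 1) ^ 4)"
  define R where "R = (\<lambda>x. sin (pi * x) / (pi * x) * ((exp (pi * x) - exp (- (pi * x))) / 2 / (pi * x)))"
  obtain Z where Z: "S \<longlonglongrightarrow> Z"
    unfolding S_def using summable_LIMSEQ[OF summable_inverse_power[of 4]] by auto
  have P_lim: "(\<lambda>N. P N x) \<longlonglongrightarrow> R x" if "x \<noteq> 0" for x
  proof -
    have "(\<lambda>N. (pi * x * (\<Prod>k=1..N. 1 - x\<^sup>2 / (real k)\<^sup>2)) / (pi * x)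
               * ((pi * x * (\<Prod>k=1..N. 1 + x\<^sup>2 / (real k)\<^sup>2)) / (pi * x))) \<longlonglongrightarrow> R x"
      unfolding R_def using that
      by (intro tendsto_mult tendsto_divide sin_product_formula_real sinh_product_formula_real tendsto_const) auto
    also have "(\<lambda>N. (pi * x * (\<Prod>k=1..N. 1 - x\<^sup>2 / (real k)\<^sup>2)) / (pi * x)
               * ((pi * x * (\<Prod>k=1..N. 1 + x\<^sup>2 / (real k)\<^sup>2)) / (pi * x))) = (\<lambda>N. P N x)"
    proof
      fix N
      have "(\<Prod>k=1..N. 1 - x\<^sup>2 / (real k)\<^sup>2) * (\<Prod>k=1..N. 1 + x\<^sup>2 / (real k)\<^sup>2)
          = (\<Prod>k=1..N. 1 - x ^ 4 / real k ^ 4)"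
        unfolding prod.distrib [symmetric] by (intro prod.cong) (auto simp: algebra_simps power2_eq_square eval_nat_numeral)
      also have "\<dots> = P N x"
        by (simp add: P_def prod.atLeast1_atMost_eq add.commute)
      finally show "(pi * x * (\<Prod>k=1..N. 1 - x\<^sup>2 / (real k)\<^sup>2)) / (pi * x)
               * ((pi * x * (\<Prod>k=1..N. 1 + x\<^sup>2 / (real k)\<^sup>2)) / (pi * x)) = P N x"
        using that by simp
    qed
    finally show ?thesis .
  qed
  have bounds: "Z * R x \<le> (1 - R x) / x ^ 4 \<and> (1 - R x) / x ^ 4 \<le> Z" if x: "0 < x" "x < 1" for x
  proof -
    have factor: "0 \<le> 1 - x ^ 4 / (real j + 1) ^ 4" "1 - x ^ 4 / (real j + 1) ^ 4 \<le> 1" for j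
      using x power_mono[of x "real j + 1" 4] by (auto simp: divide_simps)
    have P_01: "0 \<le> P N x" "P N x \<le> 1" for N
      unfolding P_def by (intro prod_nonneg prod_le_1 ballI conjI factor)+
    have P_anti: "P N x \<le> P k x" if "k \<le> N" for k N
      using that
    proof (induction rule: dec_induct)
      case (step i)
      have "P (Suc i) x \<le> P i x" unfolding P_def prod.lessThan_Suc
        using P_01[of i] factor[of i] by (intro mult_left_le) (auto simp: P_def)
      thus ?case using step by simp
    qed auto
    have "1 - P N x = (\<Sum>k<N. P k x * (x ^ 4 / (real k + 1) ^ 4))" for N
      by (induction N) (auto simp: P_def algebra_simps)
    hence tel: "(1 - P N x) / x ^ 4 = (\<Sum>k<N. P k x * (1 / (real k + 1) ^ 4))" for N
      using x by (simp add: sum_divide_distrib)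
    have 1: "S N * P N x \<le> (1 - P N x) / x ^ 4" for N
    proof -
      have "S N * P N x = (\<Sum>k<N. P N x * (1 / (real k + 1) ^ 4))"
        by (simp add: S_def sum_distrib_left mult.commute)
      also have "\<dots> \<le> (\<Sum>k<N. P k x * (1 / (real k + 1) ^ 4))"
        by (intro sum_mono mult_right_mono P_anti) auto
      finally show ?thesis unfolding tel .
    qed
    have 2: "(1 - P N x) / x ^ 4 \<le> S N" for N
      unfolding tel S_def by (intro sum_mono mult_left_le_one_le P_01) auto
    have lim: "(\<lambda>N. (1 - P N x) / x ^ 4) \<longlonglongrightarrow> (1 - R x) / x ^ 4"
      using x by (intro tendsto_intros P_lim) auto
    have "Z * R x \<le> (1 - R x) / x ^ 4"
      using x 1 by (intro LIMSEQ_le[OF tendsto_mult[OF Z P_lim] lim]) auto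
    moreover have "(1 - R x) / x ^ 4 \<le> Z"
      using 2 by (intro LIMSEQ_le[OF lim Z]) auto
    ultimately show ?thesis by blast
  qed
  have R1: "((\<lambda>x. Z * R x) \<longlongrightarrow> Z * 1) (at_right 0)"
    unfolding R_def by (intro tendsto_mult_left) real_asymp
  have R2: "((\<lambda>x. (1 - R x) / x ^ 4) \<longlongrightarrow> pi ^ 4 / 90) (at_right 0)"
    unfolding R_def by real_asymp (simp add: field_simps power4_eq_xxxx)
  have ev: "\<forall>\<^sub>F x in at_right 0. Z * R x \<le> (1 - R x) / x ^ 4 \<and> (1 - R x) / x ^ 4 \<le> Z"
    using eventually_at_right_real[of 0 1] by (rule eventually_mono) (auto simp: bounds)
  have "\<forall>\<^sub>F x in at_right 0. Z * R x \<le> (1 - R x) / x ^ 4"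
    "\<forall>\<^sub>F x in at_right 0. (1 - R x) / x ^ 4 \<le> Z"
    using ev by (auto elim: eventually_mono)
  from tendsto_le[OF trivial_limit_at_right_real R2 R1 this(1)]
    tendsto_le[OF trivial_limit_at_right_real tendsto_const R2 this(2)]
  have "Z = pi ^ 4 / 90" by simp
  thus ?thesis using Z by (simp only: S_def)
qed

section \<open>From the accelerated series to harmonic numbers\<close>

lemma harmonic_0 [simp]: "harmonic m 0 = 0"
  by (simp add: harmonic_def)

lemma harmonic_Suc: "harmonic m (Suc n) = harmonic m n + 1 / (real n + 1) ^ m"
  by (simp add: harmonic_def add.commute)

lemma sum_half_integers: "(\<Sum>j<n. 1 / (real j + 1/2) ^ r) = 2 ^ r * harmonic r (2 * n) - harmonic r n"
proof (induction n)
  case (Suc n)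
  have idx: "2 * Suc n = Suc (Suc (2 * n))" by simp
  have "real n + 1/2 = (real (2 * n) + 1) / 2" by simp
  hence 1: "1 / (real n + 1/2) ^ r = 2 ^ r * (1 / (real (2 * n) + 1) ^ r)"
    by (simp only: power_divide) simp
  have "real (Suc (2 * n)) + 1 = 2 * (real n + 1)" by simp
  hence 2: "2 ^ r * (1 / (real (Suc (2 * n)) + 1) ^ r) = 1 / (real n + 1) ^ r"
    by (simp only: power_mult_distrib) simp
  show ?case
    unfolding idx sum.lessThan_Suc harmonic_Suc Suc.IH distrib_left 1 2 by simp
qed auto

lemma sum_shifted_half_integers:
  "(\<Sum>j<n. 1 / (real j + 3/2) ^ r) = (\<Sum>j<n. 1 / (real j + 1/2) ^ r) + 1 / (real n + 1/2) ^ r - 2 ^ r"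
proof (induction n)
  case (Suc n)
  have s: "real (Suc n) + 1/2 = real n + 3/2" by simp
  show ?case unfolding sum.lessThan_Suc Suc.IH s by simp
qed (simp add: power_divide)

lemma sum_pull_numerator: "(\<Sum>j\<in>A. c / f j) = c * (\<Sum>j\<in>A. 1 / f j)" for c :: real
  by (simp add: sum_distrib_left)

text \<open>
  The common factor of all four series. By \<open>base_F_eq_weight\<close> and \<open>base_M_eq_weight\<close> it is, up to rational
  factors and the shift \<open>k = n + 1\<close>, the unperturbed accelerated term.
\<close>
definition weight :: "nat \<Rightarrow> real" where
  "weight k = (-16) ^ k / ((2 * real k - 1)\<^sup>2 * real k ^ 3
                 * real ((2 * k) choose k) * real ((4 * k) choose (2 * k)))"

text \<open>
  Both sides are hypergeometric in \<open>n\<close> with the same term ratio.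
\<close>
lemma central_binomials_eq_decay:
  "16 ^ Suc n / (real ((2 * Suc n) choose Suc n) * real ((4 * Suc n) choose (2 * Suc n)))
     = 4 * (real n + 1)\<^sup>2 * decay n 0 / (4 * real n + 3)"
proof -
  define q :: "nat \<Rightarrow> real" where "q k = (fact k)\<^sup>2 * fact (2 * k) / fact (4 * k)" for k
  have q: "1 / (real ((2 * k) choose k) * real ((4 * k) choose (2 * k))) = q k" for k
    by (simp add: binomial_fact q_def power2_eq_square)
  have q_Suc: "q (Suc k) = q k * ((real k + 1)\<^sup>2 / (4 * ((4 * real k + 1) * (4 * real k + 3))))" for k
  proof -
    have idx: "2 * Suc k = Suc (Suc (2 * k))" "4 * Suc k = Suc (Suc (Suc (Suc (4 * k))))" by simp_all
    define A :: real where "A = fact (2 * k)"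
    define B :: real where "B = fact (4 * k)"
    define D :: real where "D = fact k"
    define y where "y = real k"
    have y: "y \<ge> 0" by (simp add: y_def)
    have f: "fact (Suc k) = (y + 1) * D" "fact (2 * Suc k) = (2 * y + 2) * ((2 * y + 1) * A)"
      "fact (4 * Suc k) = (4 * y + 4) * ((4 * y + 3) * ((4 * y + 2) * ((4 * y + 1) * B)))"
      unfolding idx fact_Suc by (simp_all add: A_def B_def D_def y_def algebra_simps)
    have nz: "B \<noteq> 0" "y + 1 \<noteq> 0" "2 * y + 1 \<noteq> 0" "4 * y + 1 \<noteq> 0" "4 * y + 3 \<noteq> 0"
      using y by (auto simp: B_def)
    have e: "4 * y + 4 = 4 * (y + 1)" "4 * y + 2 = 2 * (2 * y + 1)" "2 * y + 2 = 2 * (y + 1)" by auto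
    have cancel: "(a * D)\<^sup>2 * (2 * a * (b * A)) / (4 * a * (d * (2 * b * (c * B))))
        = D\<^sup>2 * A / B * (a\<^sup>2 / (4 * (c * d)))" if "a \<noteq> 0" "b \<noteq> 0" for a b c d :: real
      using that by (simp add: power2_eq_square mult_ac)
    show ?thesis
      unfolding q_def f A_def [symmetric] B_def [symmetric] D_def [symmetric] y_def [symmetric] e
      by (rule cancel) (use nz in auto)
  qed
  have "16 ^ Suc n * q (Suc n) = 4 * (real n + 1)\<^sup>2 * decay n 0 / (4 * real n + 3)"
  proof (induction n)
    case 0
    show ?case by (simp add: q_def decay_0 fact_numeral)
  next
    case (Suc n)
    define y where "y = real n"
    have y: "y \<ge> 0" by (simp add: y_def)
    have nz: "4 * y + 3 \<noteq> 0" "4 * y + 5 \<noteq> 0" "4 * y + 7 \<noteq> 0" using y by auto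
    have d: "decay (Suc n) 0 = decay n 0 * ((y + 1)\<^sup>2 / ((4 * y + 3) / 2 * ((4 * y + 5) / 2)))"
      unfolding decay_Suc by (simp add: y_def field_simps)
    have s: "real (Suc n) = y + 1" "real n = y" "4 * (y + 1) + 1 = 4 * y + 5" "4 * (y + 1) + 3 = 4 * y + 7"
      by (simp_all add: y_def)
    have "16 ^ Suc (Suc n) * q (Suc (Suc n))
        = 16 * (16 ^ Suc n * q (Suc n)) * ((y + 1 + 1)\<^sup>2 / (4 * ((4 * y + 5) * (4 * y + 7))))"
      unfolding q_Suc[of "Suc n"] s by simp
    also have "\<dots> = 4 * (y + 1 + 1)\<^sup>2 * decay (Suc n) 0 / (4 * y + 7)"
      unfolding Suc.IH s d using nz by (simp add: mult_ac)
    finally show ?case unfolding s .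
  qed
  thus ?thesis using q[of "Suc n"] by (metis mult.right_neutral times_divide_eq_right)
qed

lemma base_F_eq_weight:
  "-16 * base_F n 0 = 4 * real (Suc n) * (4 * real (Suc n) - 1) * weight (Suc n)"
proof -
  define y where "y = real n"
  define C where "C = real ((2 * Suc n) choose Suc n) * real ((4 * Suc n) choose (2 * Suc n))"
  have y: "y \<ge> 0" by (simp add: y_def)
  have nz: "2 * y + 1 \<noteq> 0" "y + 1 \<noteq> 0" "4 * y + 3 \<noteq> 0" using y by auto
  have s: "real (Suc n) = y + 1" "2 * (y + 1) - 1 = 2 * y + 1" "4 * (y + 1) - 1 = 4 * y + 3"
    by (simp_all add: y_def)
  have sign: "(-16 :: real) ^ Suc n = (-1) ^ Suc n * 16 ^ Suc n"
    unfolding power_mult_distrib [symmetric] by simp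
  have "weight (Suc n) = (-1) ^ Suc n * (16 ^ Suc n / C) / ((2 * y + 1)\<^sup>2 * (y + 1) ^ 3)"
    unfolding weight_def C_def s sign
    by (simp only: times_divide_eq_left times_divide_eq_right divide_divide_eq_left mult_ac)
  also have "16 ^ Suc n / C = 4 * (y + 1)\<^sup>2 * decay n 0 / (4 * y + 3)"
    unfolding C_def y_def by (rule central_binomials_eq_decay)
  finally have w: "weight (Suc n) = - ((-1) ^ n * (4 * (y + 1)\<^sup>2 * decay n 0 / (4 * y + 3)) / ((2 * y + 1)\<^sup>2 * (y + 1) ^ 3))"
    by simp
  have b: "base_F n 0 = (-1) ^ n * decay n 0 / (2 * y + 1)\<^sup>2" by (simp add: base_F_def y_def)
  have cancel: "-16 * (c * d / U\<^sup>2) = 4 * W * V * - (c * (4 * W\<^sup>2 * d / V) / (U\<^sup>2 * W ^ 3))"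
    if "U \<noteq> 0" "W \<noteq> 0" "V \<noteq> 0" for c d U V W :: real
    using that by (simp add: power2_eq_square power3_eq_cube)
  show ?thesis
    unfolding w b s by (rule cancel) (rule nz)+
qed

lemma base_M_eq_weight: "-16 * base_M n 0 = (2 * real (Suc n) - 1)\<^sup>2 * weight (Suc n)"
proof -
  define y where "y = real n"
  have y: "y \<ge> 0" by (simp add: y_def)
  have nz: "2 * y + 1 \<noteq> 0" "y + 1 \<noteq> 0" "4 * y + 3 \<noteq> 0" using y by auto
  have s: "real (Suc n) = y + 1" "2 * (y + 1) - 1 = 2 * y + 1" "4 * (y + 1) - 1 = 4 * y + 3"
    by (simp_all add: y_def)
  have b: "base_F n 0 = (-1) ^ n * decay n 0 / (2 * y + 1)\<^sup>2" by (simp add: base_F_def y_def)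
  have m: "base_M n 0 = (-1) ^ n * decay n 0 / (4 * (4 * y + 3) * (y + 1))"
  proof -
    have h: "real (2 * n + 0) + 3/2 = (4 * y + 3) / 2" "real n + 1 = y + 1" by (simp_all add: y_def)
    have "c / (8 * (V / 2) * W) = c / (4 * V * W)" for c V W :: real by simp
    thus ?thesis unfolding base_M_def h .
  qed
  have cancel: "-16 * (c * d / (4 * V * W)) = U\<^sup>2 / (4 * W * V) * (-16 * (c * d / U\<^sup>2))"
    "U\<^sup>2 / (4 * W * V) * (4 * W * V * w) = U\<^sup>2 * w"
    if "U \<noteq> 0" "W \<noteq> 0" "V \<noteq> 0" for c d w U V W :: real
    using that by (simp_all add: power2_eq_square mult_ac)
  have "-16 * base_M n 0 = (2 * y + 1)\<^sup>2 / (4 * (y + 1) * (4 * y + 3)) * (-16 * base_F n 0)"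
    unfolding m b by (rule cancel) (rule nz)+
  also have "\<dots> = (2 * y + 1)\<^sup>2 * weight (Suc n)"
    unfolding base_F_eq_weight s by (rule cancel) (rule nz)+
  finally show ?thesis unfolding s .
qed

context direction
begin

text \<open>
  On the edge \<open>k = 0\<close> every product in the term runs over integers or half-integers, so its logarithmic
  derivative is a combination of harmonic numbers.
\<close>
lemma wp_logderiv_n_0:
  "wp_logderiv n 0 = \<kappa> + \<beta> * (2 * harmonic 1 (2 * n) - harmonic 1 n) + \<delta> * (8 * harmonic 3 (2 * n) - harmonic 3 n)
     - (3 * \<alpha> - \<beta>) * (2 * harmonic 1 (2 * n) - harmonic 1 n + 1 / (real n + 1/2) - 2)
     + \<delta> * (8 * harmonic 3 (2 * n) - harmonic 3 n + 1 / (real n + 1/2) ^ 3 - 8)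
     + (\<alpha> - 2 * \<epsilon>) * harmonic 1 n - \<delta> * harmonic 3 n
     - (\<alpha> - \<epsilon>) * (2 * harmonic 1 (4 * n) - harmonic 1 (2 * n) + 1 / (2 * real n + 1/2) - 2)"
proof -
  have h: "(\<Sum>j<n. 1 / (real j + 1) ^ r) = harmonic r n" for r
    by (induction n) (auto simp: harmonic_Suc)
  have [simp]: "2 * (2 * n) = 4 * n" by simp
  note 1 = sum_half_integers[where r = 1, simplified] sum_half_integers[where r = 3]
  note 2 = sum_shifted_half_integers[where r = 1, simplified] sum_shifted_half_integers[where r = 3]
  show ?thesis
    unfolding wp_logderiv_def sum.distrib sum_subtractf sum_pull_numerator[where c = \<alpha>]
      sum_pull_numerator[where c = \<beta>] sum_pull_numerator[where c = \<epsilon>] sum_pull_numerator[where c = \<delta>]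
      sum_pull_numerator[where c = "3 * \<alpha> - \<beta>"] sum_pull_numerator[where c = "\<alpha> - 2 * \<epsilon>"]
      sum_pull_numerator[where c = "\<alpha> - \<epsilon>"]
    using h[of 1] h[of 3] by (simp add: 1 2)
qed

text \<open>
  The factor that accompanies \<open>weight k\<close> in \<open>-16 * (dF n 0 + dM n 0)\<close> for \<open>k = n + 1\<close>. Its leading part
  \<open>20 k\<^sup>2 - 8 k + 1\<close> multiplies the logarithmic derivative common to \<open>dF\<close> and \<open>dM\<close>; the remaining terms come
  from the rational factors by which \<open>F\<close> and \<open>M\<close> differ from the hypergeometric term.
\<close>
definition bracket :: "nat \<Rightarrow> real" where
  "bracket k = (20 * (real k)\<^sup>2 - 8 * real k + 1) * wp_logderiv (k - 1) 0
     + 4 * real k * (4 * real k - 1) * \<alpha> / (2 * real k - 1) + 2 * \<beta> * (2 * real k - 1)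
     + 8 * \<delta> / (2 * real k - 1) - 2 * (\<alpha> - \<epsilon>) * (2 * real k - 1)\<^sup>2 / (4 * real k - 1)
     - (2 * \<alpha> - \<epsilon> - \<beta>) * (2 * real k - 1)\<^sup>2 / real k"

lemma weight_bracket: "weight (Suc n) * bracket (Suc n) = -16 * (dF n 0 + dM n 0)"
proof -
  define y where "y = real n"
  define l where "l = wp_logderiv n 0"
  define w where "w = weight (Suc n)"
  have y: "y \<ge> 0" by (simp add: y_def)
  have nz: "2 * y + 1 \<noteq> 0" "y + 1 \<noteq> 0" "4 * y + 3 \<noteq> 0" using y by auto
  have s: "real (Suc n) = y + 1" "2 * (y + 1) - 1 = 2 * y + 1" "4 * (y + 1) - 1 = 4 * y + 3"
    "real (n + 0) = y" "real (2 * n + 0) = 2 * y" "real n = y" "Suc n - 1 = n"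
    by (simp_all add: y_def)
  have h: "y + 1/2 = (2 * y + 1) / 2" "2 * y + 3/2 = (4 * y + 3) / 2" by simp_all
  have poly: "20 * (y + 1)\<^sup>2 - 8 * (y + 1) + 1 = 4 * (y + 1) * (4 * y + 3) + (2 * y + 1)\<^sup>2"
    by algebra
  have "-16 * (dF n 0 + dM n 0) = -16 * base_F n 0 * (l + \<alpha> / (2 * y + 1))
     + -16 * base_M n 0 * (l + \<beta> / ((2 * y + 1) / 2) + \<delta> / ((2 * y + 1) / 2) ^ 3
        - (\<alpha> - \<epsilon>) / ((4 * y + 3) / 2) - (2 * \<alpha> - \<epsilon> - \<beta>) / (y + 1))"
    unfolding dF_def dM_def s h l_def by (simp add: algebra_simps)
  also have "\<dots> = w * (4 * (y + 1) * (4 * y + 3) * (l + \<alpha> / (2 * y + 1))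
     + (2 * y + 1)\<^sup>2 * (l + \<beta> / ((2 * y + 1) / 2) + \<delta> / ((2 * y + 1) / 2) ^ 3
        - (\<alpha> - \<epsilon>) / ((4 * y + 3) / 2) - (2 * \<alpha> - \<epsilon> - \<beta>) / (y + 1)))"
    unfolding base_F_eq_weight base_M_eq_weight s w_def [symmetric] by (simp only: distrib_left mult_ac)
  also have "4 * (y + 1) * (4 * y + 3) * (l + \<alpha> / (2 * y + 1))
     + (2 * y + 1)\<^sup>2 * (l + \<beta> / ((2 * y + 1) / 2) + \<delta> / ((2 * y + 1) / 2) ^ 3
        - (\<alpha> - \<epsilon>) / ((4 * y + 3) / 2) - (2 * \<alpha> - \<epsilon> - \<beta>) / (y + 1))
     = (4 * (y + 1) * (4 * y + 3) + (2 * y + 1)\<^sup>2) * l + 4 * (y + 1) * (4 * y + 3) * \<alpha> / (2 * y + 1)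
       + 2 * \<beta> * (2 * y + 1) + 8 * \<delta> / (2 * y + 1) - 2 * (\<alpha> - \<epsilon>) * (2 * y + 1)\<^sup>2 / (4 * y + 3)
       - (2 * \<alpha> - \<epsilon> - \<beta>) * (2 * y + 1)\<^sup>2 / (y + 1)"
  proof -
    have "4 * W * V * (l + \<alpha> / U) + U\<^sup>2 * (l + \<beta> / (U / 2) + \<delta> / (U / 2) ^ 3 - (\<alpha> - \<epsilon>) / (V / 2) - c / W)
       = (4 * W * V + U\<^sup>2) * l + 4 * W * V * \<alpha> / U + 2 * \<beta> * U + 8 * \<delta> / U
         - 2 * (\<alpha> - \<epsilon>) * U\<^sup>2 / V - c * U\<^sup>2 / W"
      if "U \<noteq> 0" "V \<noteq> 0" "W \<noteq> 0" for U V W c :: real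
      using that by (simp add: field_simps power2_eq_square power3_eq_cube)
    thus ?thesis using nz by blast
  qed
  also have "\<dots> = bracket (Suc n)"
    unfolding bracket_def s poly l_def by simp
  finally show ?thesis by (simp add: w_def)
qed

theorem weighted_series:
  assumes "(\<lambda>N. \<Sum>k<N. dF 0 k) \<longlonglongrightarrow> L"
    and "\<And>n. bracket (Suc n) = b (Suc n)"
  shows "(\<lambda>N. \<Sum>k=1..N. weight k * b k) \<longlonglongrightarrow> -16 * L"
proof -
  have "(\<Sum>k=1..N. weight k * b k) = -16 * (\<Sum>n<N. dF n 0 + dM n 0)" for N
    by (simp add: sum.atLeast1_atMost_eq sum_distrib_left weight_bracket assms(2) [symmetric])
  thus ?thesis using tendsto_mult_left[OF acceleration[OF assms(1)], of "-16"] by simp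
qed

end

section \<open>The four identities\<close>

lemma sum_inverse_step:
  "(\<Sum>j<k. 1 / (real j + 3/2)) = (\<Sum>j<k. 1 / (real j + 1/2)) + 2 / (2 * real k + 1) - 2"
proof -
  have "1 / (real k + 1/2) = 2 / (2 * real k + 1)" by (simp add: field_simps)
  thus ?thesis using sum_shifted_half_integers[where r = 1 and n = k] by simp
qed

lemma base_F_0: "base_F 0 k = 1 / (2 * real k + 1) ^ 3"
  by (simp add: base_F_def decay_0 power2_eq_square power3_eq_cube)

lemma harmonic_unwind:
  "harmonic m (2 * Suc n - 1) = harmonic m (2 * n) + 1 / (2 * real n + 1) ^ m"
  "harmonic m (4 * Suc n - 1) = harmonic m (4 * n) + 1 / (4 * real n + 1) ^ m
     + 1 / (4 * real n + 2) ^ m + 1 / (4 * real n + 3) ^ m"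
proof -
  have "2 * Suc n - 1 = Suc (2 * n)" "4 * Suc n - 1 = Suc (Suc (Suc (4 * n)))" by simp_all
  thus "harmonic m (2 * Suc n - 1) = harmonic m (2 * n) + 1 / (2 * real n + 1) ^ m"
    "harmonic m (4 * Suc n - 1) = harmonic m (4 * n) + 1 / (4 * real n + 1) ^ m
     + 1 / (4 * real n + 2) ^ m + 1 / (4 * real n + 3) ^ m"
    by (simp_all only: harmonic_Suc) (simp_all add: add_ac)
qed

text \<open>
  Here \<open>a = 1 + 2 x\<close>, \<open>e = 1/2 + x\<close>, and to first order \<open>\<phi> t = (t + 1/2 + x) ^ 3\<close>. All four quotients of the
  well-poised series then telescope, and \<open>\<Sum>k. F 0 k\<close> is, to first order,
  \<open>16 * (1/2 + x) ^ 4 * (\<Sum>k. 1 / (2 k + 1 + 2 x) ^ 3)\<close>. The value \<open>\<kappa> = - 8\<close> cancels the logarithmic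
  derivative of \<open>(1/2 + x) ^ 4\<close>.
\<close>
lemma series_difference:
  "(\<lambda>N. \<Sum>k=1..N. weight k * ((20 * (real k)\<^sup>2 - 8 * real k + 1)
        * (harmonic 1 (2 * k - 1) - 2 * harmonic 1 (4 * k - 1)) - 8 * real k * (6 * real k - 1) / (2 * real k - 1)))
     \<longlonglongrightarrow> pi ^ 4"
proof -
  interpret direction 2 3 1 0 "-8" .
  have "dF 0 k = - 6 * (1 / (2 * real k + 1) ^ 4)" for k
  proof -
    have "wp_logderiv 0 k = - 8 / (2 * real k + 1)"
      unfolding wp_logderiv_def
      by (simp add: sum.distrib sum_subtractf sum_pull_numerator[where c = 3] sum_inverse_step)
    thus ?thesis by (simp add: dF_def base_F_0 eval_nat_numeral add_divide_distrib [symmetric])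
  qed
  hence "(\<lambda>N. \<Sum>k<N. dF 0 k) \<longlonglongrightarrow> - 6 * ((1 - 1 / 2 ^ 4) * (pi ^ 4 / 90))"
    unfolding sum_distrib_left [symmetric]
    by (simp only: sum_distrib_left [symmetric])
       (intro tendsto_mult_left sum_odd_inverse_powers_tendsto sum_inverse_fourth_powers_tendsto)
  moreover have "bracket (Suc n) = (20 * (real (Suc n))\<^sup>2 - 8 * real (Suc n) + 1)
        * (harmonic 1 (2 * Suc n - 1) - 2 * harmonic 1 (4 * Suc n - 1))
        - 8 * real (Suc n) * (6 * real (Suc n) - 1) / (2 * real (Suc n) - 1)" for n
  proof -
    define y where "y = real n"
    have y: "y \<ge> 0" by (simp add: y_def)
    have nz: "2 * y + 1 \<noteq> 0" "4 * y + 1 \<noteq> 0" "4 * y + 3 \<noteq> 0" using y by auto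
    have s: "real (Suc n) = y + 1" "2 * (y + 1) - 1 = 2 * y + 1" "4 * (y + 1) - 1 = 4 * y + 3"
      "real n = y" "Suc n - 1 = n"
      by (simp_all add: y_def)
    have h: "y + 1/2 = (2 * y + 1) / 2" "2 * y + 1/2 = (4 * y + 1) / 2" "4 * y + 2 = 2 * (2 * y + 1)" by simp_all
    have l: "wp_logderiv n 0 = (harmonic 1 (2 * Suc n - 1) - 2 * harmonic 1 (4 * Suc n - 1))
        - 6 / (2 * y + 1) + 2 / (4 * y + 3)"
    proof -
      have "2 / (4 * y + 2) = 1 / (2 * y + 1)" "6 / (2 * y + 1) = 5 / (2 * y + 1) + 1 / (2 * y + 1)"
        using nz by (simp add: field_simps) (simp only: add_divide_distrib [symmetric], simp)
      thus ?thesis unfolding wp_logderiv_n_0 harmonic_unwind s h by simp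
    qed
    have "(20 * (y + 1)\<^sup>2 - 8 * (y + 1) + 1) * (- 6 / (2 * y + 1) + 2 / (4 * y + 3))
         + 4 * (y + 1) * (4 * y + 3) * 2 / (2 * y + 1) + 6 * (2 * y + 1) - 2 * (2 * y + 1)\<^sup>2 / (4 * y + 3)
       = - (8 * (y + 1) * (6 * (y + 1) - 1) / (2 * y + 1))"
      using nz by (simp add: divide_simps) algebra
    thus ?thesis unfolding bracket_def s l by (simp add: algebra_simps)
  qed
  ultimately have "(\<lambda>N. \<Sum>k=1..N. weight k * ((20 * (real k)\<^sup>2 - 8 * real k + 1)
        * (harmonic 1 (2 * k - 1) - 2 * harmonic 1 (4 * k - 1)) - 8 * real k * (6 * real k - 1) / (2 * real k - 1)))
     \<longlonglongrightarrow> -16 * (- 6 * ((1 - 1 / 2 ^ 4) * (pi ^ 4 / 90)))"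
    by (rule weighted_series)
  thus ?thesis by simp
qed

text \<open>
  Here one root of the cubic moves against \<open>e\<close>. The factors \<open>(1/2 + x + j) (1/2 - x + j)\<close> of the numerator
  and \<open>(3/2 - x + j) (3/2 + x + j)\<close> of the denominator are even in \<open>x\<close>, so the derivative vanishes term by
  term.
\<close>
lemma series_vanishing:
  "(\<lambda>N. \<Sum>k=1..N. weight k * ((20 * (real k)\<^sup>2 - 8 * real k + 1)
        * (5 * harmonic 1 (2 * k - 1) - 2 * harmonic 1 (4 * k - 1)) - 16 * (real k)\<^sup>2 / (2 * real k - 1)))
     \<longlonglongrightarrow> 0"
proof -
  interpret direction 0 1 "-1" 0 0 .
  have "dF 0 k = 0" for k
  proof -
    have "wp_logderiv 0 k = 0"
      unfolding wp_logderiv_def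
      by (simp add: sum.distrib sum_subtractf sum_negf)
    thus ?thesis by (simp add: dF_def)
  qed
  hence "(\<lambda>N. \<Sum>k<N. dF 0 k) \<longlonglongrightarrow> 0" by simp
  moreover have "bracket (Suc n) = (20 * (real (Suc n))\<^sup>2 - 8 * real (Suc n) + 1)
        * (5 * harmonic 1 (2 * Suc n - 1) - 2 * harmonic 1 (4 * Suc n - 1))
        - 16 * (real (Suc n))\<^sup>2 / (2 * real (Suc n) - 1)" for n
  proof -
    define y where "y = real n"
    have y: "y \<ge> 0" by (simp add: y_def)
    have nz: "2 * y + 1 \<noteq> 0" "4 * y + 1 \<noteq> 0" "4 * y + 3 \<noteq> 0" using y by auto
    have s: "real (Suc n) = y + 1" "2 * (y + 1) - 1 = 2 * y + 1" "4 * (y + 1) - 1 = 4 * y + 3"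
      "real n = y" "Suc n - 1 = n"
      by (simp_all add: y_def)
    have h: "y + 1/2 = (2 * y + 1) / 2" "2 * y + 1/2 = (4 * y + 1) / 2" "4 * y + 2 = 2 * (2 * y + 1)" by simp_all
    have l: "wp_logderiv n 0 = (5 * harmonic 1 (2 * Suc n - 1) - 2 * harmonic 1 (4 * Suc n - 1))
        - 2 / (2 * y + 1) + 2 / (4 * y + 3)"
    proof -
      have "2 / (4 * y + 2) = 1 / (2 * y + 1)" "5 / (2 * y + 1) = 2 / (2 * y + 1) + 2 / (2 * y + 1) + 1 / (2 * y + 1)"
        using nz by (simp add: field_simps) (simp only: add_divide_distrib [symmetric], simp)
      thus ?thesis unfolding wp_logderiv_n_0 harmonic_unwind s h by simp
    qed
    have "(20 * (y + 1)\<^sup>2 - 8 * (y + 1) + 1) * (- 2 / (2 * y + 1) + 2 / (4 * y + 3))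
         + 2 * (2 * y + 1) - 2 * (2 * y + 1)\<^sup>2 / (4 * y + 3)
       = - (16 * (y + 1)\<^sup>2 / (2 * y + 1))"
      using nz by (simp add: divide_simps) algebra
    thus ?thesis unfolding bracket_def s l by (simp add: algebra_simps)
  qed
  ultimately have "(\<lambda>N. \<Sum>k=1..N. weight k * ((20 * (real k)\<^sup>2 - 8 * real k + 1)
        * (5 * harmonic 1 (2 * k - 1) - 2 * harmonic 1 (4 * k - 1)) - 16 * (real k)\<^sup>2 / (2 * real k - 1)))
     \<longlonglongrightarrow> -16 * 0"
    by (rule weighted_series)
  thus ?thesis by simp
qed

text \<open>
  Here \<open>\<phi> t = (t + 1/2) ^ 3 + x\<close>. With \<open>W k = (\<Sum>j<k. 1 / (2 j + 1) ^ 3)\<close> the derivative of \<open>F 0 k\<close> is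
  \<open>8 * ((W (k + 1))\<^sup>2 - (W k)\<^sup>2)\<close>, so its sum telescopes to a square. The value \<open>\<kappa> = 8 = 1 / (1/2) ^ 3\<close>
  completes the denominator product, which starts at \<open>j + 3/2\<close>, by the missing factor for \<open>1/2\<close>.
\<close>
lemma series_cubes:
  "(\<lambda>N. \<Sum>k=1..N. weight k * ((20 * (real k)\<^sup>2 - 8 * real k + 1)
        * (16 * harmonic 3 (2 * k - 1) - 3 * harmonic 3 (k - 1)) - 32 * real k * (4 * real k - 1) / (2 * real k - 1) ^ 3))
     \<longlonglongrightarrow> - (98 * (zeta (3::real))\<^sup>2)"
proof -
  interpret direction 0 0 0 1 8 .
  define W where "W k = (\<Sum>j<k. 1 / (2 * real j + 1) ^ 3)" for k
  have "(\<Sum>k<N. dF 0 k) = 8 * (W N)\<^sup>2" for N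
  proof (induction N)
    case (Suc k)
    have half: "1 / (real j + 1/2) ^ 3 = 8 * (1 / (2 * real j + 1) ^ 3)" for j
    proof -
      have "real j + 1/2 = (2 * real j + 1) / 2" by simp
      thus ?thesis by (simp only: power_divide) simp
    qed
    have 1: "(\<Sum>j<k. 1 / (real j + 1/2) ^ 3) = 8 * W k"
      by (simp only: half W_def sum_distrib_left)
    have 2: "(\<Sum>j<k. 1 / (real j + 3/2) ^ 3) = 8 * W k + 8 * (1 / (2 * real k + 1) ^ 3) - 8"
      by (subst sum_shifted_half_integers, subst 1) (simp add: half)
    have "wp_logderiv 0 k = 16 * W k + 8 / (2 * real k + 1) ^ 3"
      unfolding wp_logderiv_def by (simp add: sum.distrib 1 2)
    hence "dF 0 k = 8 * ((W k + 1 / (2 * real k + 1) ^ 3)\<^sup>2 - (W k)\<^sup>2)"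
      by (simp add: dF_def base_F_0 power2_eq_square algebra_simps)
    thus ?case using Suc by (simp add: W_def)
  qed (simp add: W_def)
  moreover have "W \<longlonglongrightarrow> (1 - 1 / 2 ^ 3) * zeta 3"
    unfolding W_def by (intro sum_odd_inverse_powers_tendsto sum_inverse_cubes_tendsto)
  ultimately have "(\<lambda>N. \<Sum>k<N. dF 0 k) \<longlonglongrightarrow> 8 * ((1 - 1 / 2 ^ 3) * zeta 3)\<^sup>2"
    by (simp only:) (intro tendsto_intros)
  moreover have "bracket (Suc n) = (20 * (real (Suc n))\<^sup>2 - 8 * real (Suc n) + 1)
        * (16 * harmonic 3 (2 * Suc n - 1) - 3 * harmonic 3 (Suc n - 1))
        - 32 * real (Suc n) * (4 * real (Suc n) - 1) / (2 * real (Suc n) - 1) ^ 3" for n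
  proof -
    define y where "y = real n"
    have y: "y \<ge> 0" by (simp add: y_def)
    have nz: "2 * y + 1 \<noteq> 0" using y by auto
    have s: "real (Suc n) = y + 1" "2 * (y + 1) - 1 = 2 * y + 1" "4 * (y + 1) - 1 = 4 * y + 3"
      "real n = y" "Suc n - 1 = n"
      by (simp_all add: y_def)
    have h: "y + 1/2 = (2 * y + 1) / 2" by simp
    have l: "wp_logderiv n 0 = (16 * harmonic 3 (2 * Suc n - 1) - 3 * harmonic 3 n) - 8 / (2 * y + 1) ^ 3"
      unfolding wp_logderiv_n_0 harmonic_unwind s h power_divide by simp
    have "(20 * (y + 1)\<^sup>2 - 8 * (y + 1) + 1) * (- 8 / (2 * y + 1) ^ 3) + 8 / (2 * y + 1)
       = - (32 * (y + 1) * (4 * y + 3) / (2 * y + 1) ^ 3)"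
      using nz by (simp add: divide_simps) algebra
    thus ?thesis unfolding bracket_def s l by (simp add: algebra_simps)
  qed
  ultimately have "(\<lambda>N. \<Sum>k=1..N. weight k * ((20 * (real k)\<^sup>2 - 8 * real k + 1)
        * (16 * harmonic 3 (2 * k - 1) - 3 * harmonic 3 (k - 1)) - 32 * real k * (4 * real k - 1) / (2 * real k - 1) ^ 3))
     \<longlonglongrightarrow> -16 * (8 * ((1 - 1 / 2 ^ 3) * zeta 3)\<^sup>2)"
    by (rule weighted_series)
  thus ?thesis by (simp add: power_mult_distrib power2_eq_square)
qed

text \<open>
  Let \<open>A\<close> and \<open>B\<close> be the terms of \<open>series_difference\<close> and \<open>series_vanishing\<close>. Eliminating one of the two
  harmonic numbers at a time gives the first identity as \<open>(B - 5 A) / 8\<close> and the second as \<open>(B - A) / 4\<close>; the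
  third is \<open>A - 2 B\<close>.
\<close>
theorem theorem1p8:
  shows "((\<lambda>N. \<Sum>k=1..N.
            (-16) ^ k * ((20 * (real k)\<^sup>2 - 8 * real k + 1) * harmonic 1 (4 * k - 1)
                + real k * (28 * real k - 5) / (2 * real k - 1))
              / ((2 * real k - 1)\<^sup>2 * real k ^ 3
                 * real ((2 * k) choose k) * real ((4 * k) choose (2 * k))))
          \<longlonglongrightarrow> - (5 * pi ^ 4 / 8))
       \<and> ((\<lambda>N. \<Sum>k=1..N.
            (-16) ^ k * ((20 * (real k)\<^sup>2 - 8 * real k + 1) * harmonic 1 (2 * k - 1)
                + 2 * real k * (4 * real k - 1) / (2 * real k - 1))
              / ((2 * real k - 1)\<^sup>2 * real k ^ 3
                 * real ((2 * k) choose k) * real ((4 * k) choose (2 * k))))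
          \<longlonglongrightarrow> - (pi ^ 4 / 4))
       \<and> ((\<lambda>N. \<Sum>k=1..N.
            (-16) ^ k * ((20 * (real k)\<^sup>2 - 8 * real k + 1)
                * (2 * harmonic 1 (4 * k - 1) - 9 * harmonic 1 (2 * k - 1)) - 8 * real k)
              / ((2 * real k - 1)\<^sup>2 * real k ^ 3
                 * real ((2 * k) choose k) * real ((4 * k) choose (2 * k))))
          \<longlonglongrightarrow> pi ^ 4)
       \<and> ((\<lambda>N. \<Sum>k=1..N.
            (-16) ^ k * ((20 * (real k)\<^sup>2 - 8 * real k + 1)
                * (16 * harmonic 3 (2 * k - 1) - 3 * harmonic 3 (k - 1))
                - 32 * real k * (4 * real k - 1) / (2 * real k - 1) ^ 3)
              / ((2 * real k - 1)\<^sup>2 * real k ^ 3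
                 * real ((2 * k) choose k) * real ((4 * k) choose (2 * k))))
          \<longlonglongrightarrow> - (98 * (zeta (3::real))\<^sup>2))"
proof -
  define P where "P k = 20 * (real k)\<^sup>2 - 8 * real k + 1" for k
  let ?H4 = "\<lambda>k. harmonic 1 (4 * k - 1)" and ?H2 = "\<lambda>k. harmonic 1 (2 * k - 1)"
  let ?u = "\<lambda>k. 2 * real k - 1"
  define A where "A = (\<lambda>k. weight k * (P k * (?H2 k - 2 * ?H4 k) - 8 * real k * (6 * real k - 1) / ?u k))"
  define B where "B = (\<lambda>k. weight k * (P k * (5 * ?H2 k - 2 * ?H4 k) - 16 * (real k)\<^sup>2 / ?u k))"
  have A: "(\<lambda>N. \<Sum>k=1..N. A k) \<longlonglongrightarrow> pi ^ 4" and B: "(\<lambda>N. \<Sum>k=1..N. B k) \<longlonglongrightarrow> 0"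
    unfolding A_def B_def P_def by (rule series_difference series_vanishing)+
  have AB: "(\<lambda>N. \<Sum>k=1..N. a * A k + b * B k) \<longlonglongrightarrow> a * pi ^ 4 + b * 0" for a b
    unfolding sum.distrib sum_distrib_left [symmetric] by (intro tendsto_intros A B)
  have w: "(-16) ^ k * x / (?u k ^ 2 * real k ^ 3 * real ((2 * k) choose k) * real ((4 * k) choose (2 * k)))
      = weight k * x" for k x
    by (simp add: weight_def)
  have u: "?u k \<noteq> 0" for k
  proof
    assume "?u k = 0"
    hence "real (2 * k) = real 1" by simp
    hence "2 * k = 1" by (simp only: of_nat_eq_iff)
    thus False by presburger
  qed
  have r1: "weight k * (P k * ?H4 k + real k * (28 * real k - 5) / ?u k) = - 5/8 * A k + 1/8 * B k" for k
  proof -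
    have "real k * (28 * real k - 5) / ?u k
       = 5/8 * (8 * real k * (6 * real k - 1) / ?u k) - 1/8 * (16 * (real k)\<^sup>2 / ?u k)"
      using u[of k] by (simp add: divide_simps) algebra
    moreover have "v * (p * h4 + (5/8 * a - 1/8 * b))
       = - 5/8 * (v * (p * (h2 - 2 * h4) - a)) + 1/8 * (v * (p * (5 * h2 - 2 * h4) - b))"
      for v p h2 h4 a b :: real by (simp add: field_simps)
    ultimately show ?thesis unfolding A_def B_def by (simp only:)
  qed
  have r2: "weight k * (P k * ?H2 k + 2 * real k * (4 * real k - 1) / ?u k) = - 1/4 * A k + 1/4 * B k" for k
  proof -
    have "2 * real k * (4 * real k - 1) / ?u k
       = 1/4 * (8 * real k * (6 * real k - 1) / ?u k) - 1/4 * (16 * (real k)\<^sup>2 / ?u k)"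
      using u[of k] by (simp add: divide_simps) algebra
    moreover have "v * (p * h2 + (1/4 * a - 1/4 * b))
       = - 1/4 * (v * (p * (h2 - 2 * h4) - a)) + 1/4 * (v * (p * (5 * h2 - 2 * h4) - b))"
      for v p h2 h4 a b :: real by (simp add: field_simps)
    ultimately show ?thesis unfolding A_def B_def by (simp only:)
  qed
  have r3: "weight k * (P k * (2 * ?H4 k - 9 * ?H2 k) - 8 * real k) = 1 * A k + - 2 * B k" for k
  proof -
    have e: "8 * real k * (6 * real k - 1) / ?u k - 2 * (16 * (real k)\<^sup>2 / ?u k) = 8 * real k"
      using u[of k] by (simp add: divide_simps) algebra
    have "v * (p * (2 * h4 - 9 * h2) - (a - 2 * b))
       = 1 * (v * (p * (h2 - 2 * h4) - a)) + - 2 * (v * (p * (5 * h2 - 2 * h4) - b))"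
      for v p h2 h4 a b :: real by (simp add: field_simps)
    from this[of "weight k" "P k" _ _ "8 * real k * (6 * real k - 1) / ?u k" "16 * (real k)\<^sup>2 / ?u k"]
    show ?thesis unfolding A_def B_def e .
  qed
  show ?thesis
    unfolding w P_def [symmetric] r1 r2 r3
    using AB[of "- 5/8" "1/8"] AB[of "- 1/4" "1/4"] AB[of 1 "- 2"] series_cubes
    by (simp add: P_def)
qed

end
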